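(* Let $A=(A_1,\dots,A_5):I\to\mathbb{R}^{3\times5}$ be smooth on an open interval $I$, with columns linearly independent over $\mathbb{R}$ (as functions on $I$), such that $$p_{123}=p_{345}=1,\quad p_{134}-p_{235}=p_{135}+p_{234}=0,\quad p_{124}=p_{125}=p_{145}=p_{245}=0,$$ every $Q_{ij}=c_{ij}$ ($1\le i<j\le5$) is constant, and $c_{14}=c_{15}=0$. Then $c_{12}\neq0$ and, after adding to $A_3$ a suitable linear combination with constant coefficients of the other columns (which entails no loss of generality), $A=RB$ with $R(t)\in SO(3)$ and $$B=\begin{pmatrix}b_{11}&b_{12}&b_{13}&\cos(\theta)b_{11}+\sin(\theta)b_{12}&-\sin(\theta)b_{11}+\cos(\theta)b_{12}\\0&b_{22}&b_{23}&\sin(\theta)b_{22}&\cos(\theta)b_{22}\\0&0&1/(b_{11}b_{22})&0&0\end{pmatrix},$$ where $$\theta'=-\frac{c_{12}}{b_{11}^2}=-w_3,\qquad w_1=w_2=0,\qquad b_{12}=b_{13}=b_{23}=0,\qquad b_{22}=b_{11}.$$ Conversely, for every nowhere vanishing smooth $b_{11}$ and every constant $c_{12}\ne0$ such an $A$ satisfies the conditions above.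
   Context: For $A(t)\in\mathbb{R}^{3\times m}$ with columns $A_i$, set $p_{ijk}=\det(A_i,A_j,A_k)$ and $Q_{ij}=\langle A_i',A_j\rangle-\langle A_j',A_i\rangle$, $'=d/dt$. For a smooth $R(t)\in SO(3)$ the vector $w=(w_1,w_2,w_3)$ is defined by $R^TR'x=\tfrac12\,w\times x$ for all $x\in\mathbb{R}^3$ (in Euler parameters $a$ of $R$ it is $w=4H_aa'$); then $Q_{ij}=\langle w,B_i\times B_j\rangle+\langle B_i',B_j\rangle-\langle B_i,B_j'\rangle$ if $A=RB$. Here the $QR$ decomposition is taken with positive $b_{11},b_{22}$. Origin: $\varphi(z,t)=A(t)v(z)$ is sought as a solution of the 3D incompressible Euler equations in Lagrangian form, with spatial constraints $g_{134}+g_{235}=g_{135}-g_{234}=0$, $g_{ijk}=\det(\nabla v^i,\nabla v^j,\nabla v^k)$ (elliptic case). The stated conditions are the normalized constraints on the time component $A$. Adding constant multiples of the other columns to $A_3$ corresponds to $A\mapsto AH$, $v\mapsto H^{-1}v$ and preserves the spatial constraints. Solutions with columns of $A$ linearly dependent over $\mathbb{R}$ are called reducible and discarded. *)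

theory Defs
  imports "HOL-Analysis.Analysis"
begin

text \<open>Infinite differentiability on an open set \<open>I\<close>: \<open>D n\<close> is the \<open>n\<close>-th derivative on \<open>I\<close>.\<close>

definition smooth_on :: "real set \<Rightarrow> (real \<Rightarrow> 'a::real_normed_vector) \<Rightarrow> bool" where
  "smooth_on I f \<longleftrightarrow>
     (\<exists>D :: nat \<Rightarrow> real \<Rightarrow> 'a. D 0 = f \<and>
        (\<forall>n. \<forall>t\<in>I. (D n has_vector_derivative D (Suc n) t) (at t)))"

text \<open>The column index is the numeral type \<open>5\<close>, in which \<open>1, 2, 3, 4, 5\<close> are the five distinct
  elements, but \<open>5 = 0\<close>, so the order of this type is not the intended one. Whenever \<open>i < j\<close>
  matters, the indices are natural numbers, embedded by \<open>of_nat\<close>.\<close>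

definition pdet :: "real^5^3 \<Rightarrow> 5 \<Rightarrow> 5 \<Rightarrow> 5 \<Rightarrow> real" where
  "pdet M i j k = det (transpose (vector [column i M, column j M, column k M] :: real^3^3))"

definition Qform :: "(real \<Rightarrow> real^5^3) \<Rightarrow> 5 \<Rightarrow> 5 \<Rightarrow> real \<Rightarrow> real" where
  "Qform A i j t =
     vector_derivative (\<lambda>s. column i (A s)) (at t) \<bullet> column j (A t)
     - vector_derivative (\<lambda>s. column j (A s)) (at t) \<bullet> column i (A t)"

definition columns_independent_on :: "real set \<Rightarrow> (real \<Rightarrow> real^5^3) \<Rightarrow> bool" where
  "columns_independent_on I A \<longleftrightarrow>
     (\<forall>x :: 5 \<Rightarrow> real. (\<forall>t\<in>I. (\<Sum>j\<in>UNIV. x j *\<^sub>R column j (A t)) = 0) \<longrightarrow> (\<forall>j. x j = 0))"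

definition time_conditions ::
  "real set \<Rightarrow> (real \<Rightarrow> real^5^3) \<Rightarrow> (nat \<Rightarrow> nat \<Rightarrow> real) \<Rightarrow> bool" where
  "time_conditions I A c \<longleftrightarrow>
     smooth_on I A \<and> columns_independent_on I A \<and>
     (\<forall>t\<in>I. pdet (A t) 1 2 3 = 1 \<and> pdet (A t) 3 4 5 = 1 \<and>
        pdet (A t) 1 3 4 - pdet (A t) 2 3 5 = 0 \<and>
        pdet (A t) 1 3 5 + pdet (A t) 2 3 4 = 0 \<and>
        pdet (A t) 1 2 4 = 0 \<and> pdet (A t) 1 2 5 = 0 \<and>
        pdet (A t) 1 4 5 = 0 \<and> pdet (A t) 2 4 5 = 0) \<and>
     (\<forall>i j. 1 \<le> i \<and> i < j \<and> j \<le> 5 \<longrightarrow>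
        (\<forall>t\<in>I. Qform A (of_nat i) (of_nat j) t = c i j)) \<and>
     c 1 4 = 0 \<and> c 1 5 = 0"

definition add_to_third :: "(5 \<Rightarrow> real) \<Rightarrow> (real \<Rightarrow> real^5^3) \<Rightarrow> real \<Rightarrow> real^5^3" where
  "add_to_third a A t =
     (\<chi> r s. if s = 3 then A t $ r $ 3 + (\<Sum>j\<in>UNIV - {3}. a j * A t $ r $ j) else A t $ r $ s)"

text \<open>\<open>w\<close> is uniquely determined on \<open>I\<close> by \<open>R\<close>. The factor \<open>1/2\<close> is the normalization for which
  \<open>w = 4 H\<^sub>a a'\<close> in Euler parameters \<open>a\<close> of \<open>R\<close>.\<close>

definition rotation_vector_on ::
  "real set \<Rightarrow> (real \<Rightarrow> real^3^3) \<Rightarrow> (real \<Rightarrow> real^3) \<Rightarrow> bool" where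
  "rotation_vector_on I R w \<longleftrightarrow>
     (\<forall>t\<in>I. \<forall>x. (transpose (R t) ** vector_derivative R (at t)) *v x
                   = (1/2) *\<^sub>R cross3 (w t) x)"

definition Bmat :: "real \<Rightarrow> real \<Rightarrow> real \<Rightarrow> real \<Rightarrow> real \<Rightarrow> real \<Rightarrow> real^5^3" where
  "Bmat b11 b12 b13 b22 b23 \<theta> = vector
     [vector [b11, b12, b13, cos \<theta> * b11 + sin \<theta> * b12, - sin \<theta> * b11 + cos \<theta> * b12],
      vector [0, b22, b23, sin \<theta> * b22, cos \<theta> * b22],
      vector [0, 0, 1 / (b11 * b22), 0, 0]]"

definition normal_form ::
  "real set \<Rightarrow> (real \<Rightarrow> real^5^3) \<Rightarrow> real \<Rightarrow> (real \<Rightarrow> real^3^3) \<Rightarrow> (real \<Rightarrow> real) \<Rightarrow> (real \<Rightarrow> real) \<Rightarrow>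
   (real \<Rightarrow> real) \<Rightarrow> (real \<Rightarrow> real) \<Rightarrow> (real \<Rightarrow> real) \<Rightarrow> (real \<Rightarrow> real) \<Rightarrow> (real \<Rightarrow> real^3) \<Rightarrow> bool" where
  "normal_form I A c12 R b11 b12 b13 b22 b23 \<theta> w \<longleftrightarrow>
     smooth_on I R \<and> smooth_on I b11 \<and> smooth_on I b12 \<and> smooth_on I b13 \<and>
     smooth_on I b22 \<and> smooth_on I b23 \<and> smooth_on I \<theta> \<and>
     (\<forall>t\<in>I. rotation_matrix (R t)) \<and> rotation_vector_on I R w \<and>
     (\<forall>t\<in>I. A t = R t ** Bmat (b11 t) (b12 t) (b13 t) (b22 t) (b23 t) (\<theta> t)) \<and>
     (\<forall>t\<in>I. (\<theta> has_real_derivative - c12 / (b11 t)\<^sup>2) (at t) \<and>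
        - c12 / (b11 t)\<^sup>2 = - (w t $ 3) \<and> w t $ 1 = 0 \<and> w t $ 2 = 0 \<and>
        b12 t = 0 \<and> b13 t = 0 \<and> b23 t = 0 \<and> b22 t = b11 t)"

end

theory Submission
  imports Defs
begin

text \<open>
  Write \<open>A\<^sub>1, \<dots>, A\<^sub>5\<close> for the columns of \<open>A\<close>. Because \<open>p\<^sub>1\<^sub>2\<^sub>3 = 1\<close> and
  \<open>p\<^sub>1\<^sub>2\<^sub>4 = p\<^sub>1\<^sub>2\<^sub>5 = 0\<close>, the columns \<open>A\<^sub>4, A\<^sub>5\<close> lie in the plane with basis \<open>A\<^sub>1, A\<^sub>2\<close>. By Cramer's rule
  their coordinates there are determinants \<open>p\<^sub>i\<^sub>j\<^sub>k\<close>, and the other determinant conditions say that the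
  coordinates form a rotation matrix. Its angle \<open>\<theta>\<close> can be chosen smooth:
  \<open>A\<^sub>4 = cos \<theta> A\<^sub>1 + sin \<theta> A\<^sub>2\<close> and \<open>A\<^sub>5 = - sin \<theta> A\<^sub>1 + cos \<theta> A\<^sub>2\<close>
  (lemma \<open>det_conditions_imp_rotated_pair\<close>).

  The form \<open>Q\<close> is linear over constants, and the failure of linearity for the functions \<open>cos \<theta>, sin \<theta>\<close> is
  a term with the factor \<open>\<theta>'\<close>. Solving for this term gives, for every column \<open>A\<^sub>i\<close>,

  \<^item> \<open>\<theta>' \<langle>A\<^sub>1, A\<^sub>i\<rangle> = sin \<theta> Q\<^sub>i\<^sub>4 + cos \<theta> Q\<^sub>i\<^sub>5 - Q\<^sub>i\<^sub>2\<close>,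
  \<^item> \<open>\<theta>' \<langle>A\<^sub>2, A\<^sub>i\<rangle> = Q\<^sub>i\<^sub>1 - cos \<theta> Q\<^sub>i\<^sub>4 + sin \<theta> Q\<^sub>i\<^sub>5\<close>

  (lemma \<open>angular_speed_inner_products\<close>). As all \<open>Q\<^sub>i\<^sub>j\<close> are constant, these two identities determine the
  solution. For \<open>i = 1\<close> they read \<open>\<theta>' \<langle>A\<^sub>1, A\<^sub>1\<rangle> = - c\<^sub>1\<^sub>2\<close> and \<open>\<theta>' \<langle>A\<^sub>2, A\<^sub>1\<rangle> = 0\<close>. If \<open>c\<^sub>1\<^sub>2\<close> were \<open>0\<close>, then
  \<open>\<theta>\<close> would be constant and the columns \<open>A\<^sub>1, A\<^sub>2, A\<^sub>4\<close> dependent. Hence \<open>\<theta>'\<close> vanishes nowhere, \<open>A\<^sub>1\<close> and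
  \<open>A\<^sub>2\<close> are orthogonal, and \<open>1, cos \<theta>, sin \<theta>\<close> are linearly independent functions. For \<open>i = 2\<close> this
  independence gives \<open>c\<^sub>2\<^sub>4 = c\<^sub>2\<^sub>5 = 0\<close>, and then \<open>A\<^sub>2\<close> is as long as \<open>A\<^sub>1\<close> (lemma \<open>rotating_plane\<close>).

  Now \<open>Q\<^sub>1\<^sub>2 = c\<^sub>1\<^sub>2\<close>, \<open>Q\<^sub>4\<^sub>5 = - c\<^sub>1\<^sub>2\<close>, and \<open>Q\<close> is \<open>0\<close> on the other pairs from \<open>A\<^sub>1, A\<^sub>2, A\<^sub>4, A\<^sub>5\<close>. So \<open>Q\<close> is
  nondegenerate on the constant combinations of these four columns, and exactly one such combination, added to
  \<open>A\<^sub>3\<close>, makes all \<open>Q\<^sub>i\<^sub>3\<close> vanish. The identities for \<open>i = 3\<close> then say that \<open>A\<^sub>3\<close> is perpendicular to the plane. With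
  \<open>b = |A\<^sub>1|\<close> the columns \<open>A\<^sub>1, A\<^sub>2, A\<^sub>3\<close> are therefore \<open>b, b, 1/b\<^sup>2\<close> times the columns of a rotation \<open>R\<close>, and the
  angular velocity \<open>w\<close> of \<open>R\<close> is read off from \<open>Q\<^sub>1\<^sub>2 = b\<^sup>2 w\<^sub>3\<close>, \<open>Q\<^sub>1\<^sub>3 = - w\<^sub>2/b\<close>, \<open>Q\<^sub>2\<^sub>3 = w\<^sub>1/b\<close>
  (lemma \<open>Qform_Bmat\<close>).

  The same formulas, read backwards, prove the converse. For its existence part \<open>R\<close> is the rotation about the
  third axis by the angle \<open>- \<theta>/2\<close>, where \<open>\<theta>\<close> is an antiderivative of \<open>- c\<^sub>1\<^sub>2/b\<^sup>2\<close>.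
\<close>

section \<open>Smooth functions on an open set\<close>

text \<open>Smoothness is the existence of a whole sequence of derivatives at once, which is awkward for products and
  compositions. Finite orders of differentiability allow induction on the order: in each formula below, the
  derivative of a function is built from the function itself and from smooth data.\<close>

primrec times_differentiable_on ::
    "nat \<Rightarrow> real set \<Rightarrow> (real \<Rightarrow> 'a::real_normed_vector) \<Rightarrow> bool" where
  "times_differentiable_on 0 I f \<longleftrightarrow> True"
| "times_differentiable_on (Suc n) I f \<longleftrightarrow>
     (\<exists>f'. (\<forall>t\<in>I. (f has_vector_derivative f' t) (at t)) \<and> times_differentiable_on n I f')"

lemma times_differentiable_on_SucI:
  "(\<And>t. t \<in> I \<Longrightarrow> (f has_vector_derivative f' t) (at t)) \<Longrightarrow>
    times_differentiable_on n I f' \<Longrightarrow> times_differentiable_on (Suc n) I f"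
  by auto

lemma times_differentiable_on_SucD:
  "times_differentiable_on (Suc n) I f \<Longrightarrow> times_differentiable_on n I f"
  by (induction n arbitrary: f) auto

lemma times_differentiable_on_cong:
  assumes "open I" "\<And>t. t \<in> I \<Longrightarrow> f t = g t" "times_differentiable_on n I f"
  shows "times_differentiable_on n I g"
  using assms
proof (cases n)
  case (Suc m)
  then obtain f' where f': "\<forall>t\<in>I. (f has_vector_derivative f' t) (at t)"
      "times_differentiable_on m I f'"
    using assms(3) by auto
  have "(g has_vector_derivative f' t) (at t)" if "t \<in> I" for t
    using has_vector_derivative_transform_within_open[of f "f' t" t I g] f'(1) assms(1,2) that by blast
  with Suc f'(2) show ?thesis by auto
qed simp

text \<open>Derivatives of different orders, chosen separately for each order, fit together to one sequence because on an
  open set the derivative is unique.\<close>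

lemma smooth_on_iff_times_differentiable_on:
  assumes "open I"
  shows "smooth_on I f \<longleftrightarrow> (\<forall>n. times_differentiable_on n I f)"
proof
  assume "smooth_on I f"
  then obtain D where D: "D 0 = f" "\<And>n t. t \<in> I \<Longrightarrow> (D n has_vector_derivative D (Suc n) t) (at t)"
    unfolding smooth_on_def by auto
  have "times_differentiable_on n I (D m)" for n m
    by (induction n arbitrary: m) (use D(2) in auto)
  then show "\<forall>n. times_differentiable_on n I f" using D(1) by blast
next
  assume f: "\<forall>n. times_differentiable_on n I f"
  \<comment> \<open>Outside \<open>I\<close>, and where a derivative fails to exist, these values are arbitrary.\<close>
  define D where "D = (\<lambda>n. ((\<lambda>g t. vector_derivative g (at t)) ^^ n) f)"
  have step: "(\<forall>t\<in>I. (g has_vector_derivative vector_derivative g (at t)) (at t)) \<and>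
      (\<forall>n. times_differentiable_on n I (\<lambda>t. vector_derivative g (at t)))"
    if g: "\<forall>n. times_differentiable_on n I g" for g
  proof (intro conjI allI)
    obtain g' where "\<forall>t\<in>I. (g has_vector_derivative g' t) (at t)"
      using g[rule_format, of 1] by auto
    then show "\<forall>t\<in>I. (g has_vector_derivative vector_derivative g (at t)) (at t)"
      by (metis vector_derivative_at)
    fix n
    obtain g' where g': "\<forall>t\<in>I. (g has_vector_derivative g' t) (at t)" "times_differentiable_on n I g'"
      using g[rule_format, of "Suc n"] by auto
    show "times_differentiable_on n I (\<lambda>t. vector_derivative g (at t))"
      by (rule times_differentiable_on_cong[OF assms _ g'(2)]) (metis g'(1) vector_derivative_at)
  qed
  have "\<forall>m. times_differentiable_on m I (D n)" for n
  proof (induction n)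
    case (Suc n)
    have "D (Suc n) = (\<lambda>t. vector_derivative (D n) (at t))" by (simp add: D_def)
    then show ?case using step[OF Suc] by simp
  qed (simp add: D_def f)
  then have "\<forall>t\<in>I. (D n has_vector_derivative D (Suc n) t) (at t)" for n
    using step[of "D n"] by (simp add: D_def)
  then show "smooth_on I f"
    unfolding smooth_on_def by (intro exI[of _ D]) (simp add: D_def)
qed

lemma smooth_on_derivative:
  assumes "smooth_on I f"
  obtains f' where "\<And>t. t \<in> I \<Longrightarrow> (f has_vector_derivative f' t) (at t)" "smooth_on I f'"
proof -
  obtain D where D: "D 0 = f" "\<And>n t. t \<in> I \<Longrightarrow> (D n has_vector_derivative D (Suc n) t) (at t)"
    using assms unfolding smooth_on_def by auto
  moreover have "smooth_on I (D (Suc 0))"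
    unfolding smooth_on_def using D(2) by (intro exI[of _ "\<lambda>n. D (Suc n)"]) auto
  ultimately show thesis by (intro that[of "D (Suc 0)"]) auto
qed

lemma smooth_on_has_vector_derivative:
  assumes "smooth_on I f" "t \<in> I"
  shows "(f has_vector_derivative vector_derivative f (at t)) (at t)"
proof -
  obtain f' where "(f has_vector_derivative f' t) (at t)"
    using smooth_on_derivative[OF assms(1)] assms(2) by blast
  then show ?thesis by (simp add: vector_derivative_at)
qed

lemma smooth_on_antiderivative:
  assumes "\<And>t. t \<in> I \<Longrightarrow> (f has_vector_derivative f' t) (at t)" "smooth_on I f'"
  shows "smooth_on I f"
proof -
  obtain D where D: "D 0 = f'" "\<And>n t. t \<in> I \<Longrightarrow> (D n has_vector_derivative D (Suc n) t) (at t)"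
    using assms(2) unfolding smooth_on_def by auto
  have "(case_nat f D n has_vector_derivative case_nat f D (Suc n) t) (at t)" if "t \<in> I" for n t
    using assms(1)[OF that] D(2)[OF that] by (cases n) (simp_all add: D(1))
  then show ?thesis
    unfolding smooth_on_def by (intro exI[of _ "case_nat f D"]) simp
qed

lemma smooth_on_cong:
  assumes "open I" "\<And>t. t \<in> I \<Longrightarrow> f t = g t" "smooth_on I f"
  shows "smooth_on I g"
proof -
  have "times_differentiable_on n I g" for n
    by (rule times_differentiable_on_cong[of I f])
       (use assms smooth_on_iff_times_differentiable_on[OF assms(1), of f] in simp_all)
  then show ?thesis by (simp add: smooth_on_iff_times_differentiable_on[OF assms(1)])
qed

lemma smooth_on_linear:
  assumes "bounded_linear h" "smooth_on I f"
  shows "smooth_on I (\<lambda>t. h (f t))"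
proof -
  obtain D where "D 0 = f" "\<And>n t. t \<in> I \<Longrightarrow> (D n has_vector_derivative D (Suc n) t) (at t)"
    using assms(2) unfolding smooth_on_def by auto
  then show ?thesis
    unfolding smooth_on_def using bounded_linear.has_vector_derivative[OF assms(1)]
    by (intro exI[of _ "\<lambda>n t. h (D n t)"]) auto
qed

lemma smooth_on_const: "smooth_on I (\<lambda>t. c)"
  unfolding smooth_on_def
  by (rule exI[of _ "\<lambda>n t. if n = 0 then c else 0"]) (auto simp: has_vector_derivative_const)

lemma smooth_on_add:
  assumes "smooth_on I f" "smooth_on I g"
  shows "smooth_on I (\<lambda>t. f t + g t)"
proof -
  obtain D E where "D 0 = f" "\<And>n t. t \<in> I \<Longrightarrow> (D n has_vector_derivative D (Suc n) t) (at t)"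
    "E 0 = g" "\<And>n t. t \<in> I \<Longrightarrow> (E n has_vector_derivative E (Suc n) t) (at t)"
    using assms unfolding smooth_on_def by metis
  then show ?thesis
    unfolding smooth_on_def 
    by (intro exI[of _ "\<lambda>n t. D n t + E n t"]) (auto intro!: has_vector_derivative_add)
qed

lemma smooth_on_minus: "smooth_on I f \<Longrightarrow> smooth_on I (\<lambda>t. - f t)"
  by (rule smooth_on_linear[OF bounded_linear_minus[OF bounded_linear_ident]])

lemma smooth_on_diff:
  "smooth_on I f \<Longrightarrow> smooth_on I g \<Longrightarrow> smooth_on I (\<lambda>t. f t - g t)"
  using smooth_on_add[OF _ smooth_on_minus] by fastforce

lemma smooth_on_sum:
  "(\<And>i. i \<in> S \<Longrightarrow> smooth_on I (f i)) \<Longrightarrow> smooth_on I (\<lambda>t. \<Sum>i\<in>S. f i t)"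
  by (induction S rule: infinite_finite_induct) (auto intro: smooth_on_const smooth_on_add)

lemma times_differentiable_on_add:
  "times_differentiable_on n I f \<Longrightarrow> times_differentiable_on n I g \<Longrightarrow>
    times_differentiable_on n I (\<lambda>t. f t + g t)"
proof (induction n arbitrary: f g)
  case (Suc n)
  then obtain f' g' where "\<forall>t\<in>I. (f has_vector_derivative f' t) (at t)" "times_differentiable_on n I f'"
    "\<forall>t\<in>I. (g has_vector_derivative g' t) (at t)" "times_differentiable_on n I g'" by auto
  then show ?case using Suc.IH
    by (auto intro!: exI[of _ "\<lambda>t. f' t + g' t"] has_vector_derivative_add)
qed simp

lemma times_differentiable_on_bilinear:
  assumes "bounded_bilinear prd"
  shows "times_differentiable_on n I f \<Longrightarrow> times_differentiable_on n I g \<Longrightarrow>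
    times_differentiable_on n I (\<lambda>t. prd (f t) (g t))"
proof (induction n arbitrary: f g)
  case (Suc n)
  then obtain f' g' where D: "\<forall>t\<in>I. (f has_vector_derivative f' t) (at t)" "times_differentiable_on n I f'"
    "\<forall>t\<in>I. (g has_vector_derivative g' t) (at t)" "times_differentiable_on n I g'" by auto
  have "\<forall>t\<in>I. ((\<lambda>t. prd (f t) (g t)) has_vector_derivative prd (f t) (g' t) + prd (f' t) (g t)) (at t)"
    using bounded_bilinear.has_vector_derivative[OF assms] D by blast
  moreover have "times_differentiable_on n I (\<lambda>t. prd (f t) (g' t) + prd (f' t) (g t))"
    by (intro times_differentiable_on_add Suc.IH D times_differentiable_on_SucD[OF Suc.prems(1)]
        times_differentiable_on_SucD[OF Suc.prems(2)])
  ultimately show ?case by auto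
qed simp

lemma smooth_on_bilinear:
  assumes "open I" "bounded_bilinear prd" "smooth_on I f" "smooth_on I g"
  shows "smooth_on I (\<lambda>t. prd (f t) (g t))"
  using assms(3,4) times_differentiable_on_bilinear[OF assms(2)]
  unfolding smooth_on_iff_times_differentiable_on[OF assms(1)] by blast

lemmas smooth_on_mult = smooth_on_bilinear[OF _ bounded_bilinear_mult]
lemmas smooth_on_inner = smooth_on_bilinear[OF _ bounded_bilinear_inner]
lemmas smooth_on_scaleR = smooth_on_bilinear[OF _ bounded_bilinear_scaleR]

text \<open>The derivative \<open>- f' (1/f)\<^sup>2\<close> is again built from \<open>1/f\<close>, so that each order follows from the previous one.
  The square root and the pair of cosine and sine below follow the same pattern.\<close>

lemma smooth_on_inverse:
  fixes f :: "real \<Rightarrow> real"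
  assumes "open I" "smooth_on I f" "\<And>t. t \<in> I \<Longrightarrow> f t \<noteq> 0"
  shows "smooth_on I (\<lambda>t. inverse (f t))"
proof -
  note iff = smooth_on_iff_times_differentiable_on[OF assms(1)]
  obtain f' where f': "\<And>t. t \<in> I \<Longrightarrow> (f has_vector_derivative f' t) (at t)" "smooth_on I f'"
    using smooth_on_derivative[OF assms(2)] by metis
  have d: "((\<lambda>t. inverse (f t)) has_vector_derivative - f' t * (inverse (f t) * inverse (f t))) (at t)"
    if "t \<in> I" for t
    using f'(1)[OF that] assms(3)[OF that]
    unfolding has_real_derivative_iff_has_vector_derivative[symmetric]
    by (auto intro!: derivative_eq_intros)
  have "times_differentiable_on n I (\<lambda>t. inverse (f t))" for n
  proof (induction n)
    case (Suc n)
    have "times_differentiable_on n I (\<lambda>t. - f' t * (inverse (f t) * inverse (f t)))"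
      using smooth_on_minus[OF f'(2)] Suc.IH unfolding iff
      by (intro times_differentiable_on_bilinear[OF bounded_bilinear_mult]) auto
    then show ?case
      using times_differentiable_on_SucI[OF d] by simp
  qed simp
  then show ?thesis unfolding iff by blast
qed

lemma smooth_on_divide:
  fixes f g :: "real \<Rightarrow> real"
  assumes "open I" "smooth_on I f" "smooth_on I g" "\<And>t. t \<in> I \<Longrightarrow> g t \<noteq> 0"
  shows "smooth_on I (\<lambda>t. f t / g t)"
  using smooth_on_mult[OF assms(1,2) smooth_on_inverse[OF assms(1,3,4)]] by (simp add: divide_inverse)

lemma smooth_on_sqrt:
  assumes "open I" "smooth_on I f" "\<And>t. t \<in> I \<Longrightarrow> f t > 0"
  shows "smooth_on I (\<lambda>t. sqrt (f t))"
proof -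
  note iff = smooth_on_iff_times_differentiable_on[OF assms(1)]
  obtain f' where f': "\<And>t. t \<in> I \<Longrightarrow> (f has_vector_derivative f' t) (at t)" "smooth_on I f'"
    using smooth_on_derivative[OF assms(2)] by metis
  define k where "k = (\<lambda>t. f' t / (2 * f t))"
  have d: "((\<lambda>t. sqrt (f t)) has_vector_derivative k t * sqrt (f t)) (at t)" if "t \<in> I" for t
    using f'(1)[OF that] assms(3)[OF that]
    unfolding has_real_derivative_iff_has_vector_derivative[symmetric] k_def
    by (auto intro!: derivative_eq_intros simp: field_simps)
  have "smooth_on I k"
    unfolding k_def using assms(3)
    by (intro smooth_on_divide smooth_on_mult smooth_on_const assms f') force
  then have "times_differentiable_on n I (\<lambda>t. sqrt (f t))" for n
  proof (induction n)
    case (Suc n)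
    then have "times_differentiable_on n I (\<lambda>t. k t * sqrt (f t))"
      unfolding iff by (intro times_differentiable_on_bilinear[OF bounded_bilinear_mult]) auto
    then show ?case
      using times_differentiable_on_SucI[OF d] by simp
  qed simp
  then show ?thesis unfolding iff by blast
qed

lemma smooth_on_cos_sin:
  fixes f :: "real \<Rightarrow> real"
  assumes "open I" "smooth_on I f"
  shows "smooth_on I (\<lambda>t. cos (f t))" "smooth_on I (\<lambda>t. sin (f t))"
proof -
  note iff = smooth_on_iff_times_differentiable_on[OF assms(1)]
  obtain f' where f': "\<And>t. t \<in> I \<Longrightarrow> (f has_vector_derivative f' t) (at t)" "smooth_on I f'"
    using smooth_on_derivative[OF assms(2)] by metis
  have d: "((\<lambda>t. cos (f t)) has_vector_derivative - f' t * sin (f t)) (at t)"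
    "((\<lambda>t. sin (f t)) has_vector_derivative f' t * cos (f t)) (at t)" if "t \<in> I" for t
    using f'(1)[OF that]
    unfolding has_real_derivative_iff_has_vector_derivative[symmetric]
    by (auto intro!: derivative_eq_intros)
  have "times_differentiable_on n I (\<lambda>t. cos (f t)) \<and> times_differentiable_on n I (\<lambda>t. sin (f t))" for n
  proof (induction n)
    case (Suc n)
    have "times_differentiable_on n I (\<lambda>t. - f' t * sin (f t))"
      "times_differentiable_on n I (\<lambda>t. f' t * cos (f t))"
      using f'(2) smooth_on_minus[OF f'(2)] Suc.IH unfolding iff
      by (intro times_differentiable_on_bilinear[OF bounded_bilinear_mult]; blast)+
    then show ?case
      using times_differentiable_on_SucI[OF d(1)] times_differentiable_on_SucI[OF d(2)] by simp
  qed simp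
  then show "smooth_on I (\<lambda>t. cos (f t))" "smooth_on I (\<lambda>t. sin (f t))" unfolding iff by blast+
qed

text \<open>A vector is the sum of its entries, each placed on its axis by a linear map.\<close>

lemma smooth_on_vec:
  fixes f :: "real \<Rightarrow> ('a::euclidean_space)^'n"
  assumes "\<And>i. smooth_on I (\<lambda>t. f t $ i)"
  shows "smooth_on I f"
proof -
  have "bounded_linear (axis i :: 'a \<Rightarrow> 'a^'n)" for i
    unfolding linear_conv_bounded_linear[symmetric]
    by (rule linearI) (auto simp: vec_eq_iff axis_def)
  then have "smooth_on I (\<lambda>t. \<Sum>i\<in>UNIV. axis i (f t $ i))"
    using smooth_on_linear[OF _ assms] by (intro smooth_on_sum) blast
  moreover have "(\<lambda>t. \<Sum>i\<in>UNIV. axis i (f t $ i)) = f"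
    by (auto simp: fun_eq_iff vec_eq_iff axis_def)
  ultimately show ?thesis by simp
qed

lemma smooth_on_vec_nth: "smooth_on I f \<Longrightarrow> smooth_on I (\<lambda>t. f t $ i)"
  by (rule smooth_on_linear[OF bounded_linear_vec_nth])

section \<open>Antiderivatives and smooth angles\<close>

lemma smooth_on_imp_antiderivative:
  fixes f :: "real \<Rightarrow> real"
  assumes "open I" "is_interval I" "smooth_on I f"
  obtains F where "smooth_on I F" "\<And>t. t \<in> I \<Longrightarrow> (F has_real_derivative f t) (at t)"
proof (cases "I = {}")
  case True
  then show thesis using that smooth_on_const by blast
next
  case False
  \<comment> \<open>Antiderivatives are known for intervals given by end points, which may be infinite here.\<close>
  define a b where "a = (INF x\<in>I. ereal x)" "b = (SUP x\<in>I. ereal x)"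
  have I: "x \<in> I" if "a < ereal x" "ereal x < b" for x
  proof -
    have "(\<exists>y\<in>I. y < x) \<and> (\<exists>z\<in>I. x < z)"
      using that by (simp add: a_b_def INF_less_iff less_SUP_iff)
    then obtain y z where "y \<in> I" "y < x" "z \<in> I" "x < z" by blast
    then show ?thesis using assms(2) unfolding is_interval_1 by (meson less_imp_le)
  qed
  have ends: "a < ereal x \<and> ereal x < b" if "x \<in> I" for x
  proof -
    have "\<exists>e>0. cball x e \<subseteq> I"
      using assms(1) that by (simp add: open_contains_cball)
    then obtain e where e: "e > 0" "cball x e \<subseteq> I" by blast
    then have "x - e \<in> I" "x + e \<in> I"
      by (auto simp: subset_iff mem_cball dist_real_def)
    then show ?thesis
      unfolding a_b_def INF_less_iff less_SUP_iff using e(1)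
      by (intro conjI bexI[of _ "x - e"] bexI[of _ "x + e"]) auto
  qed
  have "isCont f x" if "x \<in> I" for x
    using smooth_on_has_vector_derivative[OF assms(3) that] has_vector_derivative_continuous by blast
  moreover have "a < b" using False ends less_trans by blast
  ultimately obtain F where "\<forall>x. a < ereal x \<longrightarrow> ereal x < b \<longrightarrow> (F has_vector_derivative f x) (at x)"
    using einterval_antiderivative[of a b f] I by blast
  then have "\<And>t. t \<in> I \<Longrightarrow> (F has_vector_derivative f t) (at t)" using ends by blast
  then show thesis
    using that smooth_on_antiderivative[OF _ assms(3)]
    unfolding has_real_derivative_iff_has_vector_derivative by blast
qed

lemma constant_on_interval:
  fixes f :: "real \<Rightarrow> real"
  assumes "open I" "is_interval I" "\<And>t. t \<in> I \<Longrightarrow> (f has_real_derivative 0) (at t)" "s \<in> I" "t \<in> I"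
  shows "f s = f t"
proof -
  have "(f has_derivative (\<lambda>x. 0)) (at x)" if "x \<in> I" for x
    using assms(3)[OF that] by (simp add: has_field_derivative_def lambda_zero)
  then show ?thesis
    using has_derivative_zero_unique_connected[OF assms(1) is_interval_connected[OF assms(2)] _ assms(4,5)]
    by blast
qed

text \<open>The angle is the integral of the angular speed \<open>\<alpha> \<beta>' - \<beta> \<alpha>'\<close>, started at an angle of the point
  \<open>(\<alpha> t\<^sub>0, \<beta> t\<^sub>0)\<close>. The unit vector \<open>(cos \<theta>, sin \<theta>)\<close> and \<open>(\<alpha>, \<beta>)\<close> then rotate with the same speed, so the
  angle between them stays \<open>0\<close>.\<close>

lemma smooth_angle:
  fixes \<alpha> \<beta> :: "real \<Rightarrow> real"
  assumes I: "open I" "is_interval I"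
    and smooth: "smooth_on I \<alpha>" "smooth_on I \<beta>"
    and unit: "\<And>t. t \<in> I \<Longrightarrow> (\<alpha> t)\<^sup>2 + (\<beta> t)\<^sup>2 = 1"
  obtains \<theta> where "smooth_on I \<theta>" "\<And>t. t \<in> I \<Longrightarrow> cos (\<theta> t) = \<alpha> t \<and> sin (\<theta> t) = \<beta> t"
proof (cases "I = {}")
  case True
  then show thesis using that smooth_on_const by blast
next
  case False
  then obtain t0 where t0: "t0 \<in> I" by auto
  obtain \<alpha>' \<beta>' where d: "\<And>t. t \<in> I \<Longrightarrow> (\<alpha> has_real_derivative \<alpha>' t) (at t)" "smooth_on I \<alpha>'"
     "\<And>t. t \<in> I \<Longrightarrow> (\<beta> has_real_derivative \<beta>' t) (at t)" "smooth_on I \<beta>'"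
    using smooth_on_derivative[OF smooth(1)] smooth_on_derivative[OF smooth(2)]
    unfolding has_real_derivative_iff_has_vector_derivative by metis
  define \<omega> where "\<omega> = (\<lambda>t. \<alpha> t * \<beta>' t - \<beta> t * \<alpha>' t)"
  have "smooth_on I \<omega>"
    unfolding \<omega>_def by (intro smooth_on_diff smooth_on_mult I smooth d)
  then obtain F where F: "smooth_on I F" "\<And>t. t \<in> I \<Longrightarrow> (F has_real_derivative \<omega> t) (at t)"
    using smooth_on_imp_antiderivative[OF I] by blast
  obtain x0 where x0: "\<alpha> t0 = cos x0" "\<beta> t0 = sin x0"
    using sincos_total_2pi unit[OF t0] by metis
  define \<theta> where "\<theta> = (\<lambda>t. F t + (x0 - F t0))"
  have \<theta>: "(\<theta> has_real_derivative \<omega> t) (at t)" if "t \<in> I" for t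
    unfolding \<theta>_def using F(2)[OF that] by (auto intro!: derivative_eq_intros)
  have rot: "\<alpha>' t = - \<omega> t * \<beta> t" "\<beta>' t = \<omega> t * \<alpha> t" if "t \<in> I" for t
  proof -
    have "((\<lambda>t. (\<alpha> t)\<^sup>2 + (\<beta> t)\<^sup>2) has_real_derivative 2 * (\<alpha> t * \<alpha>' t + \<beta> t * \<beta>' t)) (at t)"
      using d(1,3)[OF that] by (auto intro!: derivative_eq_intros simp: algebra_simps)
    moreover have "((\<lambda>t. (\<alpha> t)\<^sup>2 + (\<beta> t)\<^sup>2) has_real_derivative 0) (at t)"
      by (rule has_field_derivative_transform_within_open[OF _ I(1) that, where f = "\<lambda>_. 1"]) (use unit in auto)
    ultimately have "\<alpha> t * \<alpha>' t + \<beta> t * \<beta>' t = 0"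
      using DERIV_unique by fastforce
    then show "\<alpha>' t = - \<omega> t * \<beta> t" "\<beta>' t = \<omega> t * \<alpha> t"
      using unit[OF that] unfolding \<omega>_def by algebra+
  qed
  \<comment> \<open>Cosine and sine of the angle between the two unit vectors.\<close>
  let ?p = "\<lambda>t. \<alpha> t * cos (\<theta> t) + \<beta> t * sin (\<theta> t)"
  let ?q = "\<lambda>t. \<beta> t * cos (\<theta> t) - \<alpha> t * sin (\<theta> t)"
  have "(?p has_real_derivative 0) (at t)" "(?q has_real_derivative 0) (at t)" if "t \<in> I" for t
    using d(1,3)[OF that] \<theta>[OF that] rot[OF that]
    by (auto intro!: derivative_eq_intros simp: algebra_simps)
  then have "?p t = ?p t0 \<and> ?q t = ?q t0" if "t \<in> I" for t
    using constant_on_interval[OF I _ that t0, of ?p] constant_on_interval[OF I _ that t0, of ?q] by blast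
  moreover have "?p t0 = 1" "?q t0 = 0"
    by (auto simp: \<theta>_def x0 simp flip: power2_eq_square)
  ultimately have pq: "?p t = 1 \<and> ?q t = 0" if "t \<in> I" for t using that by metis
  have "cos (\<theta> t) = \<alpha> t \<and> sin (\<theta> t) = \<beta> t" if "t \<in> I" for t
  proof -
    have "(\<alpha> t - cos (\<theta> t))\<^sup>2 + (\<beta> t - sin (\<theta> t))\<^sup>2 = 0"
      using pq[OF that] unit[OF that] sin_cos_squared_add[of "\<theta> t"]
      by (simp add: power2_diff algebra_simps)
    then show ?thesis by (simp add: sum_power2_eq_zero_iff)
  qed
  moreover have "smooth_on I \<theta>"
    unfolding \<theta>_def by (intro smooth_on_add F smooth_on_const)
  ultimately show thesis using that by blast
qed

section \<open>The index type of the columns\<close>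

lemma exhaust_5: "x = 1 \<or> x = 2 \<or> x = 3 \<or> x = 4 \<or> x = 5" for x :: 5
proof (induct x)
  case (of_int z)
  then have "z = 0 \<or> z = 1 \<or> z = 2 \<or> z = 3 \<or> z = 4" by fastforce
  then show ?case by auto
qed

lemma forall_5: "(\<forall>i::5. P i) \<longleftrightarrow> P 1 \<and> P 2 \<and> P 3 \<and> P 4 \<and> P 5"
  by (metis exhaust_5)

lemma UNIV_5: "UNIV = {1::5, 2, 3, 4, 5}"
  using exhaust_5 by auto

lemma sum_5: "sum f (UNIV::5 set) = f 1 + f 2 + f 3 + f 4 + f 5"
  unfolding UNIV_5 by (simp add: ac_simps)

lemma vector_5:
  "(vector [x1, x2, x3, x4, x5] :: 'a::zero^5) $ 1 = x1"
  "(vector [x1, x2, x3, x4, x5] :: 'a::zero^5) $ 2 = x2"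
  "(vector [x1, x2, x3, x4, x5] :: 'a::zero^5) $ 3 = x3"
  "(vector [x1, x2, x3, x4, x5] :: 'a::zero^5) $ 4 = x4"
  "(vector [x1, x2, x3, x4, x5] :: 'a::zero^5) $ 5 = x5"
  unfolding vector_def by simp_all

lemma all_pairs_le_5:
  "(\<forall>i j::nat. 1 \<le> i \<and> i < j \<and> j \<le> 5 \<longrightarrow> P i j) \<longleftrightarrow>
    P 1 2 \<and> P 1 3 \<and> P 1 4 \<and> P 1 5 \<and> P 2 3 \<and> P 2 4 \<and> P 2 5 \<and> P 3 4 \<and> P 3 5 \<and> P 4 5"
  (is "?L \<longleftrightarrow> ?R")
proof
  assume R: ?R
  show ?L
  proof (intro allI impI)
    fix i j :: nat assume "1 \<le> i \<and> i < j \<and> j \<le> 5"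
    then have "i \<in> {1,2,3,4} \<and> j \<in> {2,3,4,5} \<and> i < j" by auto
    then show "P i j" using R by auto
  qed
qed auto

section \<open>Columns of matrices\<close>

lemma bounded_linear_column: "bounded_linear (column i :: real^'n^'m \<Rightarrow> real^'m)"
  unfolding linear_conv_bounded_linear[symmetric]
  by (rule linearI) (auto simp: vec_eq_iff column_def)

lemmas smooth_on_column = smooth_on_linear[OF bounded_linear_column]

lemma matrix_eq_columns: "M = N \<longleftrightarrow> (\<forall>j. column j M = column j N)"
  by (auto simp: vec_eq_iff column_def)

lemma smooth_on_columns:
  fixes A :: "real \<Rightarrow> real^'n^'m"
  assumes "\<And>j. smooth_on I (\<lambda>t. column j (A t))"
  shows "smooth_on I A"
proof (intro smooth_on_vec)
  fix i j
  show "smooth_on I (\<lambda>t. A t $ i $ j)"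
    using smooth_on_vec_nth[OF assms, of j i] by (simp add: column_def)
qed

lemma smooth_on_cross:
  assumes "open I" "smooth_on I f" "smooth_on I g"
  shows "smooth_on I (\<lambda>t. cross3 (f t) (g t))"
  using smooth_on_bilinear[OF assms(1) bilinear_conv_bounded_bilinear[THEN iffD1, OF bilinear_cross] assms(2,3)] .

section \<open>The determinants and the form Q\<close>

lemma pdet_triple: "pdet M i j k = column i M \<bullet> cross3 (column j M) (column k M)"
  by (simp add: pdet_def det_transpose dot_cross_det)

definition det_conditions :: "real^5^3 \<Rightarrow> bool" where
  "det_conditions M \<longleftrightarrow> pdet M 1 2 3 = 1 \<and> pdet M 3 4 5 = 1 \<and>
     pdet M 1 3 4 - pdet M 2 3 5 = 0 \<and> pdet M 1 3 5 + pdet M 2 3 4 = 0 \<and>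
     pdet M 1 2 4 = 0 \<and> pdet M 1 2 5 = 0 \<and> pdet M 1 4 5 = 0 \<and> pdet M 2 4 5 = 0"

text \<open>Ten separate equations instead of a condition on pairs \<open>i < j\<close> of natural numbers, because the order of the
  index type \<open>5\<close> is of no use.\<close>

lemma time_conditions_iff:
  "time_conditions I A c \<longleftrightarrow>
     smooth_on I A \<and> columns_independent_on I A \<and> (\<forall>t\<in>I. det_conditions (A t)) \<and>
     (\<forall>t\<in>I. Qform A 1 2 t = c 1 2) \<and> (\<forall>t\<in>I. Qform A 1 3 t = c 1 3) \<and>
     (\<forall>t\<in>I. Qform A 1 4 t = 0) \<and> (\<forall>t\<in>I. Qform A 1 5 t = 0) \<and>
     (\<forall>t\<in>I. Qform A 2 3 t = c 2 3) \<and> (\<forall>t\<in>I. Qform A 2 4 t = c 2 4) \<and>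
     (\<forall>t\<in>I. Qform A 2 5 t = c 2 5) \<and> (\<forall>t\<in>I. Qform A 3 4 t = c 3 4) \<and>
     (\<forall>t\<in>I. Qform A 3 5 t = c 3 5) \<and> (\<forall>t\<in>I. Qform A 4 5 t = c 4 5) \<and>
     c 1 4 = 0 \<and> c 1 5 = 0"
  unfolding time_conditions_def all_pairs_le_5 det_conditions_def by auto

lemma Qform_swap: "Qform A j i t = - Qform A i j t"
  by (simp add: Qform_def)

lemma Qform_self: "Qform A i i t = 0"
  by (simp add: Qform_def)

lemma Qform_eqI:
  assumes "((\<lambda>s. column i (A s)) has_vector_derivative d) (at t)"
    and "((\<lambda>s. column j (A s)) has_vector_derivative e) (at t)"
  shows "Qform A i j t = d \<bullet> column j (A t) - e \<bullet> column i (A t)"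
  using assms by (simp add: Qform_def vector_derivative_at)

lemma column_has_vector_derivative:
  fixes A :: "real \<Rightarrow> real^'n^'m"
  assumes "smooth_on I A" "t \<in> I"
  shows "((\<lambda>s. column i (A s)) has_vector_derivative column i (vector_derivative A (at t))) (at t)"
  by (rule bounded_linear.has_vector_derivative[OF bounded_linear_column
      smooth_on_has_vector_derivative[OF assms]])

text \<open>Cramer's rule. It also holds when \<open>x, y, z\<close> are dependent, where it becomes a linear relation.\<close>

lemma cramer3:
  "(x \<bullet> cross3 y z) *\<^sub>R u =
    (u \<bullet> cross3 y z) *\<^sub>R x + (x \<bullet> cross3 u z) *\<^sub>R y + (x \<bullet> cross3 y u) *\<^sub>R z"
  by (simp add: cross3_simps forall_3)

lemma inner_cross_combination:
  "u \<bullet> cross3 (a *\<^sub>R x + b *\<^sub>R y) (c *\<^sub>R x + d *\<^sub>R y) = (a * d - b * c) * (u \<bullet> cross3 x y)"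
  by (simp add: cross3_simps)

section \<open>Rotated pairs of columns\<close>

definition rotated_pair :: "(real^5^3) \<Rightarrow> real \<Rightarrow> bool" where
  "rotated_pair M \<theta> \<longleftrightarrow>
     column 4 M = cos \<theta> *\<^sub>R column 1 M + sin \<theta> *\<^sub>R column 2 M \<and>
     column 5 M = - sin \<theta> *\<^sub>R column 1 M + cos \<theta> *\<^sub>R column 2 M"

text \<open>Because \<open>p\<^sub>1\<^sub>2\<^sub>4 = p\<^sub>1\<^sub>2\<^sub>5 = 0\<close>, Cramer's rule expresses \<open>A\<^sub>4, A\<^sub>5\<close> through \<open>A\<^sub>1, A\<^sub>2\<close>. The two mixed
  conditions say that the \<open>2 \<times> 2\<close> coordinate matrix has the form of a complex number, and \<open>p\<^sub>3\<^sub>4\<^sub>5 = p\<^sub>1\<^sub>2\<^sub>3\<close> says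
  that its determinant is \<open>1\<close>.\<close>

lemma det_conditions_columns:
  assumes "det_conditions M"
  shows "column 4 M = pdet M 2 3 4 *\<^sub>R column 1 M + (- pdet M 1 3 4) *\<^sub>R column 2 M"
    and "column 5 M = pdet M 1 3 4 *\<^sub>R column 1 M + pdet M 2 3 4 *\<^sub>R column 2 M"
    and "(pdet M 2 3 4)\<^sup>2 + (- pdet M 1 3 4)\<^sup>2 = 1"
proof -
  note p = assms[unfolded det_conditions_def pdet_triple]
  let ?a = "\<lambda>i. column i M"
  have perm: "u \<bullet> cross3 y z = y \<bullet> cross3 z u" "x \<bullet> cross3 u z = - (x \<bullet> cross3 z u)" for x y z u :: "real^3"
    by (simp_all add: cross3_simps)
  have "?a 4 = (?a 4 \<bullet> cross3 (?a 2) (?a 3)) *\<^sub>R ?a 1 + (?a 1 \<bullet> cross3 (?a 4) (?a 3)) *\<^sub>R ?a 2"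
    using cramer3[of "?a 1" "?a 2" "?a 3" "?a 4"] p by simp
  then show 4: "?a 4 = pdet M 2 3 4 *\<^sub>R ?a 1 + (- pdet M 1 3 4) *\<^sub>R ?a 2"
    unfolding pdet_triple perm(1)[of "?a 4" "?a 2" "?a 3"] perm(2)[of "?a 1" "?a 4" "?a 3"] .
  have "?a 5 = (?a 5 \<bullet> cross3 (?a 2) (?a 3)) *\<^sub>R ?a 1 + (?a 1 \<bullet> cross3 (?a 5) (?a 3)) *\<^sub>R ?a 2"
    using cramer3[of "?a 1" "?a 2" "?a 3" "?a 5"] p by simp
  then have "?a 5 = pdet M 2 3 5 *\<^sub>R ?a 1 + (- pdet M 1 3 5) *\<^sub>R ?a 2"
    unfolding pdet_triple perm(1)[of "?a 5" "?a 2" "?a 3"] perm(2)[of "?a 1" "?a 5" "?a 3"] .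
  moreover have "pdet M 2 3 5 = pdet M 1 3 4" "- pdet M 1 3 5 = pdet M 2 3 4"
    using assms unfolding det_conditions_def by auto
  ultimately show 5: "?a 5 = pdet M 1 3 4 *\<^sub>R ?a 1 + pdet M 2 3 4 *\<^sub>R ?a 2" by simp
  have "1 = ?a 3 \<bullet> cross3 (?a 4) (?a 5)" using p by simp
  also have "\<dots> = ((pdet M 2 3 4)\<^sup>2 + (- pdet M 1 3 4)\<^sup>2) * (?a 3 \<bullet> cross3 (?a 1) (?a 2))"
    unfolding 4 5 inner_cross_combination by (simp add: power2_eq_square)
  also have "?a 3 \<bullet> cross3 (?a 1) (?a 2) = 1" using p perm(1) by metis
  finally show "(pdet M 2 3 4)\<^sup>2 + (- pdet M 1 3 4)\<^sup>2 = 1" by simp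
qed

lemma det_conditions_imp_rotated_pair:
  assumes I: "open I" "is_interval I" and A: "smooth_on I A" "\<And>t. t \<in> I \<Longrightarrow> det_conditions (A t)"
  obtains \<theta> where "smooth_on I \<theta>" "\<And>t. t \<in> I \<Longrightarrow> rotated_pair (A t) (\<theta> t)"
proof -
  have "smooth_on I (\<lambda>t. pdet (A t) i j k)" for i j k
    unfolding pdet_triple by (intro smooth_on_inner smooth_on_cross I(1) smooth_on_column A(1))
  note p = this
  obtain \<theta> where \<theta>: "smooth_on I \<theta>"
    "\<And>t. t \<in> I \<Longrightarrow> cos (\<theta> t) = pdet (A t) 2 3 4 \<and> sin (\<theta> t) = - pdet (A t) 1 3 4"
    using smooth_angle[OF I p[of 2 3 4] smooth_on_minus[OF p[of 1 3 4]]
          det_conditions_columns(3)[OF A(2)]] by blast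
  show thesis
  proof (rule that[OF \<theta>(1)])
    fix t assume "t \<in> I"
    then show "rotated_pair (A t) (\<theta> t)"
      using det_conditions_columns(1,2)[OF A(2)] \<theta>(2) unfolding rotated_pair_def by simp
  qed
qed

lemma rotated_pair_imp_det_conditions:
  assumes "rotated_pair M \<theta>" "pdet M 1 2 3 = 1"
  shows "det_conditions M"
proof -
  let ?a = "\<lambda>i. column i M"
  have perm: "y \<bullet> cross3 x z = - (x \<bullet> cross3 y z)" "z \<bullet> cross3 x y = x \<bullet> cross3 y z"
      "x \<bullet> cross3 z y = - (x \<bullet> cross3 y z)" "y \<bullet> cross3 z x = x \<bullet> cross3 y z"
      "z \<bullet> cross3 y x = - (x \<bullet> cross3 y z)" for x y z :: "real^3"
    by (simp_all add: cross3_simps)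
  show ?thesis
    using assms unfolding det_conditions_def pdet_triple rotated_pair_def
    by (simp add: cross_add_left cross_add_right cross_mult_left cross_mult_right inner_add_left inner_add_right
        dot_cross_self perm[where x = "?a 1" and y = "?a 2" and z = "?a 3"]
        Cross3.left_diff_distrib Cross3.right_diff_distrib inner_diff_left inner_diff_right
        flip: power2_eq_square)
qed

lemma inner_rotated_pair:
  assumes "rotated_pair M \<theta>"
  shows "column 4 M \<bullet> v = cos \<theta> * (column 1 M \<bullet> v) + sin \<theta> * (column 2 M \<bullet> v)"
    and "column 5 M \<bullet> v = - sin \<theta> * (column 1 M \<bullet> v) + cos \<theta> * (column 2 M \<bullet> v)"
  using assms by (simp_all add: rotated_pair_def inner_add_left inner_diff_left)

lemma rotated_pair_length:
  assumes "rotated_pair M \<theta>" "column 1 M \<bullet> column 2 M = 0"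
    "column 2 M \<bullet> column 2 M = column 1 M \<bullet> column 1 M"
  shows "column 4 M \<bullet> column 4 M = column 1 M \<bullet> column 1 M"
proof -
  note e = inner_rotated_pair(1)[OF assms(1)]
  have "column 2 M \<bullet> column 1 M = 0" using assms(2) by (simp add: inner_commute)
  then have "column 1 M \<bullet> column 4 M = cos \<theta> * (column 1 M \<bullet> column 1 M)"
    and "column 2 M \<bullet> column 4 M = sin \<theta> * (column 1 M \<bullet> column 1 M)"
    using e[of "column 1 M"] e[of "column 2 M"] assms(2,3)
    by (simp_all add: inner_commute[of _ "column 4 M"])
  then have "column 4 M \<bullet> column 4 M = ((cos \<theta>)\<^sup>2 + (sin \<theta>)\<^sup>2) * (column 1 M \<bullet> column 1 M)"
    using e[of "column 4 M"] by (simp add: power2_eq_square ring_distribs del: sin_cos_squared_add3)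
  then show ?thesis by simp
qed

text \<open>\<open>Q\<close> would be linear in \<open>A\<^sub>4\<close> if \<open>cos \<theta>, sin \<theta>\<close> were constant. The term in \<open>\<theta>'\<close> is the derivative of these
  coefficients; rotating the coordinates turns \<open>A\<^sub>4\<close> into \<open>A\<^sub>5\<close> and \<open>A\<^sub>5\<close> into \<open>- A\<^sub>4\<close>.\<close>

lemma Qform_rotated_pair:
  assumes "open I" "smooth_on I A" "\<And>s. s \<in> I \<Longrightarrow> rotated_pair (A s) (\<theta> s)"
    and t: "t \<in> I" "(\<theta> has_real_derivative \<theta>') (at t)"
  shows "Qform A i 4 t = cos (\<theta> t) * Qform A i 1 t + sin (\<theta> t) * Qform A i 2 t
            - \<theta>' * (column 5 (A t) \<bullet> column i (A t))"
    and "Qform A i 5 t = - sin (\<theta> t) * Qform A i 1 t + cos (\<theta> t) * Qform A i 2 t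
            + \<theta>' * (column 4 (A t) \<bullet> column i (A t))"
proof -
  let ?a = "\<lambda>i. column i (A t)" and ?d = "\<lambda>i. column i (vector_derivative A (at t))"
  note d = column_has_vector_derivative[OF assms(2) t(1)]
  have e4: "?a 4 = cos (\<theta> t) *\<^sub>R ?a 1 + sin (\<theta> t) *\<^sub>R ?a 2"
    and e5: "?a 5 = (- sin (\<theta> t)) *\<^sub>R ?a 1 + cos (\<theta> t) *\<^sub>R ?a 2"
    using assms(3)[OF t(1)] by (simp_all add: rotated_pair_def)
  note Q12 = Qform_eqI[OF d[of i] d[of 1]] Qform_eqI[OF d[of i] d[of 2]]
  have "((\<lambda>s. cos (\<theta> s)) has_real_derivative - sin (\<theta> t) * \<theta>') (at t)"
    "((\<lambda>s. sin (\<theta> s)) has_real_derivative cos (\<theta> t) * \<theta>') (at t)"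
    "((\<lambda>s. - sin (\<theta> s)) has_real_derivative - cos (\<theta> t) * \<theta>') (at t)"
    using t(2) by (auto intro!: derivative_eq_intros)
  note cs = this
  have "((\<lambda>s. cos (\<theta> s) *\<^sub>R column 1 (A s) + sin (\<theta> s) *\<^sub>R column 2 (A s)) has_vector_derivative
      (cos (\<theta> t) *\<^sub>R ?d 1 + (- sin (\<theta> t) * \<theta>') *\<^sub>R ?a 1) +
      (sin (\<theta> t) *\<^sub>R ?d 2 + (cos (\<theta> t) * \<theta>') *\<^sub>R ?a 2)) (at t)"
    by (intro has_vector_derivative_add has_vector_derivative_scaleR cs d)
  then have "((\<lambda>s. column 4 (A s)) has_vector_derivative
      (cos (\<theta> t) *\<^sub>R ?d 1 + (- sin (\<theta> t) * \<theta>') *\<^sub>R ?a 1) +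
      (sin (\<theta> t) *\<^sub>R ?d 2 + (cos (\<theta> t) * \<theta>') *\<^sub>R ?a 2)) (at t)"
    by (rule has_vector_derivative_transform_within_open[OF _ assms(1) t(1)])
       (use assms(3) in \<open>simp add: rotated_pair_def\<close>)
  from Qform_eqI[OF d this]
  show "Qform A i 4 t = cos (\<theta> t) * Qform A i 1 t + sin (\<theta> t) * Qform A i 2 t
            - \<theta>' * (column 5 (A t) \<bullet> column i (A t))"
    unfolding Q12 e4 e5 by (simp add: inner_add_left inner_diff_left inner_diff_right inner_add_right algebra_simps)
  have "((\<lambda>s. - sin (\<theta> s) *\<^sub>R column 1 (A s) + cos (\<theta> s) *\<^sub>R column 2 (A s)) has_vector_derivative
      (- sin (\<theta> t) *\<^sub>R ?d 1 + (- cos (\<theta> t) * \<theta>') *\<^sub>R ?a 1) +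
      (cos (\<theta> t) *\<^sub>R ?d 2 + (- sin (\<theta> t) * \<theta>') *\<^sub>R ?a 2)) (at t)"
    by (intro has_vector_derivative_add has_vector_derivative_scaleR cs d)
  then have "((\<lambda>s. column 5 (A s)) has_vector_derivative
      (- sin (\<theta> t) *\<^sub>R ?d 1 + (- cos (\<theta> t) * \<theta>') *\<^sub>R ?a 1) +
      (cos (\<theta> t) *\<^sub>R ?d 2 + (- sin (\<theta> t) * \<theta>') *\<^sub>R ?a 2)) (at t)"
    by (rule has_vector_derivative_transform_within_open[OF _ assms(1) t(1)])
       (use assms(3) in \<open>simp add: rotated_pair_def\<close>)
  from Qform_eqI[OF d this]
  show "Qform A i 5 t = - sin (\<theta> t) * Qform A i 1 t + cos (\<theta> t) * Qform A i 2 t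
            + \<theta>' * (column 4 (A t) \<bullet> column i (A t))"
    unfolding Q12 e4 e5 by (simp add: inner_add_left inner_diff_left inner_diff_right inner_add_right algebra_simps)
qed

text \<open>The two equations for \<open>Q\<^sub>i\<^sub>4, Q\<^sub>i\<^sub>5\<close>, rotated back by the angle \<open>\<theta>\<close>. The right-hand sides contain nothing but
  \<open>\<theta>\<close> and values of \<open>Q\<close>; this is what makes the constancy of \<open>Q\<close> restrictive.\<close>

lemma angular_speed_inner_products:
  assumes "open I" "smooth_on I A" "\<And>s. s \<in> I \<Longrightarrow> rotated_pair (A s) (\<theta> s)"
    and t: "t \<in> I" "(\<theta> has_real_derivative \<theta>') (at t)"
  shows "\<theta>' * (column 1 (A t) \<bullet> column i (A t)) =
      sin (\<theta> t) * Qform A i 4 t + cos (\<theta> t) * Qform A i 5 t - Qform A i 2 t"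
    and "\<theta>' * (column 2 (A t) \<bullet> column i (A t)) =
      Qform A i 1 t - cos (\<theta> t) * Qform A i 4 t + sin (\<theta> t) * Qform A i 5 t"
proof -
  note Q = Qform_rotated_pair[OF assms, of i]
  have cs: "(cos (\<theta> t))\<^sup>2 + (sin (\<theta> t))\<^sup>2 = 1" by simp
  note 4 = inner_rotated_pair(1)[OF assms(3)[OF t(1)]] and 5 = inner_rotated_pair(2)[OF assms(3)[OF t(1)]]
  show "\<theta>' * (column 1 (A t) \<bullet> column i (A t)) =
      sin (\<theta> t) * Qform A i 4 t + cos (\<theta> t) * Qform A i 5 t - Qform A i 2 t"
    using Q cs unfolding 4 5 by algebra
  show "\<theta>' * (column 2 (A t) \<bullet> column i (A t)) =
      Qform A i 1 t - cos (\<theta> t) * Qform A i 4 t + sin (\<theta> t) * Qform A i 5 t"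
    using Q cs unfolding 4 5 by algebra
qed

text \<open>Where \<open>\<theta>'\<close> is not \<open>0\<close>, differentiating a relation and dividing by \<open>\<theta>'\<close> turns the coefficients \<open>(p, q, r)\<close> into
  \<open>(q, - p, 0)\<close>. Doing this twice leaves the two equations of a rotation applied to \<open>(p, q)\<close>.\<close>

lemma cos_sin_const_independent:
  fixes \<theta> \<theta>' :: "real \<Rightarrow> real"
  assumes "open I" "t\<^sub>0 \<in> I"
    and \<theta>: "\<And>t. t \<in> I \<Longrightarrow> (\<theta> has_real_derivative \<theta>' t) (at t)" "\<And>t. t \<in> I \<Longrightarrow> \<theta>' t \<noteq> 0"
    and zero: "\<And>t. t \<in> I \<Longrightarrow> p * cos (\<theta> t) + q * sin (\<theta> t) + r = 0"
  shows "p = 0 \<and> q = 0 \<and> r = 0"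
proof -
  have step: "q * cos (\<theta> t) + (- p) * sin (\<theta> t) + 0 = 0"
    if "\<And>t. t \<in> I \<Longrightarrow> p * cos (\<theta> t) + q * sin (\<theta> t) + r = 0" "t \<in> I" for p q r t
  proof -
    have "((\<lambda>t. p * cos (\<theta> t) + q * sin (\<theta> t) + r) has_real_derivative
        \<theta>' t * (q * cos (\<theta> t) - p * sin (\<theta> t))) (at t)"
      using \<theta>(1)[OF that(2)] by (auto intro!: derivative_eq_intros simp: algebra_simps)
    moreover have "((\<lambda>t. p * cos (\<theta> t) + q * sin (\<theta> t) + r) has_real_derivative 0) (at t)"
      by (rule has_field_derivative_transform_within_open[OF _ assms(1) that(2), where f = "\<lambda>_. 0"])
         (use that(1) in auto)
    ultimately show ?thesis using DERIV_unique \<theta>(2)[OF that(2)] by fastforce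
  qed
  have d1: "q * cos (\<theta> t) + (- p) * sin (\<theta> t) + 0 = 0" if "t \<in> I" for t
    by (rule step[of p q r, OF zero that])
  have d2: "(- p) * cos (\<theta> t) + (- q) * sin (\<theta> t) + 0 = 0" if "t \<in> I" for t
    by (rule step[of q "- p" 0, OF d1 that])
  have "p = 0 \<and> q = 0"
    using d1[OF assms(2)] d2[OF assms(2)] sin_cos_squared_add[of "\<theta> t\<^sub>0"] by algebra
  then show ?thesis using zero[OF assms(2)] by simp
qed

section \<open>Consequences of constant Q\<close>

text \<open>For the angle \<open>\<theta>\<close> of \<open>det_conditions_imp_rotated_pair\<close>, the speed and the inner products come from
  \<open>angular_speed_inner_products\<close> with \<open>i = 1\<close> and \<open>i = 2\<close>. The independence of the columns enters through
  \<open>c\<^sub>1\<^sub>2 \<noteq> 0\<close>, and \<open>c\<^sub>4\<^sub>5\<close> is \<open>Qform_rotated_pair\<close> with \<open>i = 4\<close>.\<close>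

lemma rotating_plane:
  assumes I: "open I" "is_interval I" "I \<noteq> {}" and tc: "time_conditions I A c"
  obtains \<theta> where "smooth_on I \<theta>" "\<And>t. t \<in> I \<Longrightarrow> rotated_pair (A t) (\<theta> t)" "c 1 2 \<noteq> 0"
    "\<And>t. t \<in> I \<Longrightarrow> (\<theta> has_real_derivative - c 1 2 / (column 1 (A t) \<bullet> column 1 (A t))) (at t)"
    "\<And>t. t \<in> I \<Longrightarrow> column 1 (A t) \<bullet> column 2 (A t) = 0"
    "\<And>t. t \<in> I \<Longrightarrow> column 2 (A t) \<bullet> column 2 (A t) = column 1 (A t) \<bullet> column 1 (A t)"
    "c 2 4 = 0" "c 2 5 = 0" "c 4 5 = - c 1 2"
proof -
  note tcs = tc[unfolded time_conditions_iff]
  obtain t0 where t0: "t0 \<in> I" using I(3) by blast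
  have A: "smooth_on I A" and det: "\<And>t. t \<in> I \<Longrightarrow> det_conditions (A t)" using tcs by blast+
  obtain \<theta> where \<theta>: "smooth_on I \<theta>" and rot: "\<And>t. t \<in> I \<Longrightarrow> rotated_pair (A t) (\<theta> t)"
    using det_conditions_imp_rotated_pair[OF I(1,2) A det] by blast
  define \<theta>' where "\<theta>' = (\<lambda>t. vector_derivative \<theta> (at t))"
  have \<theta>': "(\<theta> has_real_derivative \<theta>' t) (at t)" if "t \<in> I" for t
    using smooth_on_has_vector_derivative[OF \<theta> that]
    unfolding \<theta>'_def has_real_derivative_iff_has_vector_derivative .
  let ?a = "\<lambda>t i. column i (A t)"
  have pos: "?a t 1 \<bullet> ?a t 1 > 0" if "t \<in> I" for t
  proof -
    have "?a t 1 \<noteq> 0" using det[OF that] by (auto simp: det_conditions_def pdet_triple)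
    then show ?thesis by simp
  qed
  have key: "\<theta>' t * (?a t 1 \<bullet> ?a t i) =
      sin (\<theta> t) * Qform A i 4 t + cos (\<theta> t) * Qform A i 5 t - Qform A i 2 t"
    "\<theta>' t * (?a t 2 \<bullet> ?a t i) =
      Qform A i 1 t - cos (\<theta> t) * Qform A i 4 t + sin (\<theta> t) * Qform A i 5 t" if "t \<in> I" for t i
    using angular_speed_inner_products[of I A \<theta> t "\<theta>' t" i] I(1) A rot \<theta>'[OF that] that by simp_all
  have Q: "Qform A 1 2 t = c 1 2" "Qform A 2 1 t = - c 1 2" "Qform A 1 4 t = 0" "Qform A 1 5 t = 0"
      "Qform A 2 4 t = c 2 4" "Qform A 2 5 t = c 2 5" "Qform A 4 5 t = c 4 5"
      "Qform A 4 1 t = 0" "Qform A 4 2 t = - c 2 4" if "t \<in> I" for t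
    using tcs that Qform_swap[of A 2 1 t] Qform_swap[of A 4 1 t] Qform_swap[of A 4 2 t] by simp_all
  have speed: "\<theta>' t * (?a t 1 \<bullet> ?a t 1) = - c 1 2" and orth0: "\<theta>' t * (?a t 2 \<bullet> ?a t 1) = 0"
    if "t \<in> I" for t
    using key[OF that, of 1] Q[OF that] by (simp_all add: Qform_self)
  have c12: "c 1 2 \<noteq> 0"
  proof
    assume "c 1 2 = 0"
    then have "(\<theta> has_real_derivative 0) (at t)" if "t \<in> I" for t
      using \<theta>'[OF that] speed[OF that] pos[OF that] by simp
    then have const: "\<theta> t = \<theta> t0" if "t \<in> I" for t
      using constant_on_interval[OF I(1,2) _ that t0] by blast
    \<comment> \<open>With a constant angle, the formula for \<open>A\<^sub>4\<close> is a linear relation between columns.\<close>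
    define x :: "5 \<Rightarrow> real" where
      "x j = (if j = 1 then - cos (\<theta> t0) else if j = 2 then - sin (\<theta> t0) else if j = 4 then 1 else 0)" for j
    have "(\<Sum>j\<in>UNIV. x j *\<^sub>R ?a t j) = 0" if "t \<in> I" for t
      using rot[OF that] const[OF that] by (simp add: sum_5 x_def rotated_pair_def)
    then have "x 4 = 0"
      using tcs unfolding columns_independent_on_def by blast
    then show False by (simp add: x_def)
  qed
  have \<theta>'_nz: "\<theta>' t \<noteq> 0" if "t \<in> I" for t using speed[OF that] c12 by auto
  have orth: "?a t 2 \<bullet> ?a t 1 = 0" if "t \<in> I" for t using orth0[OF that] \<theta>'_nz[OF that] by simp
  have "c 2 5 * cos (\<theta> t) + c 2 4 * sin (\<theta> t) + 0 = 0" if "t \<in> I" for t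
    using key(1)[OF that, of 2] Q[OF that] orth[OF that]
    by (simp add: Qform_self inner_commute algebra_simps)
  from cos_sin_const_independent[OF I(1) t0 \<theta>' \<theta>'_nz this]
  have c245: "c 2 4 = 0" "c 2 5 = 0" by auto
  have "\<theta>' t * (?a t 2 \<bullet> ?a t 2) = \<theta>' t * (?a t 1 \<bullet> ?a t 1)" if "t \<in> I" for t
    using key(2)[OF that, of 2] Q[OF that] speed[OF that] by (simp add: c245)
  then have len: "?a t 2 \<bullet> ?a t 2 = ?a t 1 \<bullet> ?a t 1" if "t \<in> I" for t
    using \<theta>'_nz[OF that] that mult_left_cancel by blast
  have "?a t0 4 \<bullet> ?a t0 4 = ?a t0 1 \<bullet> ?a t0 1"
    by (rule rotated_pair_length[OF rot[OF t0] _ len[OF t0]]) (simp add: orth[OF t0] inner_commute[of "?a t0 1"])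
  then have c45: "c 4 5 = - c 1 2"
    using Qform_rotated_pair(2)[of I A \<theta> t0 "\<theta>' t0" 4] I(1) A rot t0 \<theta>'[OF t0] Q[OF t0] speed[OF t0]
    by (simp add: c245)
  show thesis
  proof (rule that[OF \<theta> rot c12 _ _ _ c245 c45])
    fix t assume t: "t \<in> I"
    have "\<theta>' t = - c 1 2 / (?a t 1 \<bullet> ?a t 1)"
      using speed[OF t] pos[OF t] by (simp add: field_simps)
    then show "(\<theta> has_real_derivative - c 1 2 / (?a t 1 \<bullet> ?a t 1)) (at t)" using \<theta>'[OF t] by simp
    show "?a t 1 \<bullet> ?a t 2 = 0" using orth[OF t] by (simp add: inner_commute)
    show "?a t 2 \<bullet> ?a t 2 = ?a t 1 \<bullet> ?a t 1" by (rule len[OF t])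
  qed
qed

section \<open>Changing the third column\<close>

lemma column_add_to_third:
  "column j (add_to_third a A t) =
    (if j = 3 then column 3 (A t) + a 1 *\<^sub>R column 1 (A t) + a 2 *\<^sub>R column 2 (A t)
       + a 4 *\<^sub>R column 4 (A t) + a 5 *\<^sub>R column 5 (A t) else column j (A t))"
proof -
  have "UNIV - {3} = {1::5, 2, 4, 5}" using exhaust_5 by auto
  then show ?thesis
    by (simp add: vec_eq_iff column_def add_to_third_def)
qed

lemma pdet_alternating:
  "pdet M i i k = 0" "pdet M i k k = 0" "pdet M j i k = - pdet M i j k" "pdet M i k j = - pdet M i j k"
  "pdet M j k i = pdet M i j k"
  unfolding pdet_triple by (simp_all add: cross3_simps)

lemma pdet_add_to_third:
  assumes "i \<noteq> 3" "k \<noteq> 3"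
  shows "pdet (add_to_third a A t) i 3 k = pdet (A t) i 3 k + a 1 * pdet (A t) i 1 k
    + a 2 * pdet (A t) i 2 k + a 4 * pdet (A t) i 4 k + a 5 * pdet (A t) i 5 k"
  unfolding pdet_triple using assms
  by (simp add: column_add_to_third cross_add_left cross_mult_left inner_add_right)

text \<open>A determinant with the third column changes by multiples of determinants with two equal columns or of the
  vanishing determinants \<open>p\<^sub>1\<^sub>2\<^sub>4, p\<^sub>1\<^sub>2\<^sub>5, p\<^sub>1\<^sub>4\<^sub>5, p\<^sub>2\<^sub>4\<^sub>5\<close>.\<close>

lemma det_conditions_add_to_third:
  assumes "det_conditions (A t)"
  shows "det_conditions (add_to_third a A t)"
proof -
  let ?p = "pdet (A t)" and ?q = "pdet (add_to_third a A t)"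
  have p: "?p 1 2 3 = 1" "?p 3 4 5 = 1" "?p 1 3 4 = ?p 2 3 5" "?p 1 3 5 = - ?p 2 3 4"
      "?p 1 2 4 = 0" "?p 1 2 5 = 0" "?p 1 4 5 = 0" "?p 2 4 5 = 0"
    using assms unfolding det_conditions_def by auto
  have p': "?p 2 4 1 = 0" "?p 2 5 1 = 0" "?p 5 1 4 = 0" "?p 5 2 4 = 0" "?p 1 5 4 = 0"
      "?p 2 1 5 = 0" "?p 2 1 4 = 0" "?p 2 5 4 = 0" "?p 2 3 1 = 1" "?p 5 3 4 = 1"
    using p pdet_alternating(5)[of "A t" 2 4 1] pdet_alternating(5)[of "A t" 2 5 1]
      pdet_alternating(5)[of "A t" 1 4 5] pdet_alternating(5)[of "A t" 2 4 5]
      pdet_alternating(4)[of "A t" 1 5 4] pdet_alternating(3)[of "A t" 2 1 5]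
      pdet_alternating(3)[of "A t" 2 1 4] pdet_alternating(4)[of "A t" 2 5 4]
      pdet_alternating(5)[of "A t" 2 3 1] pdet_alternating(5)[of "A t" 3 4 5] by simp_all
  \<comment> \<open>Cyclic shifts bring the third column into the middle, where its linear expansion is available.\<close>
  have "?q 1 2 3 = ?q 2 3 1" "?q 3 4 5 = ?q 5 3 4"
    using pdet_alternating(5)[of _ 2 3 1] pdet_alternating(5)[of _ 3 4 5] by simp_all
  moreover have "?q 1 2 4 = ?p 1 2 4" "?q 1 2 5 = ?p 1 2 5" "?q 1 4 5 = ?p 1 4 5" "?q 2 4 5 = ?p 2 4 5"
    unfolding pdet_triple by (simp_all add: column_add_to_third)
  ultimately show ?thesis
    unfolding det_conditions_def by (simp add: pdet_add_to_third p p' pdet_alternating(1,2))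
qed

lemma Qform_add_to_third:
  assumes "smooth_on I A" "t \<in> I" "i \<noteq> 3"
  shows "j \<noteq> 3 \<Longrightarrow> Qform (add_to_third a A) i j t = Qform A i j t"
    and "Qform (add_to_third a A) i 3 t = Qform A i 3 t + a 1 * Qform A i 1 t + a 2 * Qform A i 2 t
       + a 4 * Qform A i 4 t + a 5 * Qform A i 5 t"
proof -
  let ?d = "\<lambda>i. column i (vector_derivative A (at t))"
  note d = column_has_vector_derivative[OF assms(1,2)]
  have sc: "((\<lambda>s. r *\<^sub>R column j (A s)) has_vector_derivative r *\<^sub>R ?d j) (at t)" for r j
    by (rule bounded_linear.has_vector_derivative[OF bounded_linear_scaleR_right d])
  have i: "((\<lambda>s. column i (add_to_third a A s)) has_vector_derivative ?d i) (at t)" if "i \<noteq> 3" for i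
    using d[of i] that by (simp add: column_add_to_third)
  have "((\<lambda>s. column 3 (add_to_third a A s)) has_vector_derivative
      ?d 3 + a 1 *\<^sub>R ?d 1 + a 2 *\<^sub>R ?d 2 + a 4 *\<^sub>R ?d 4 + a 5 *\<^sub>R ?d 5) (at t)"
    unfolding column_add_to_third by (auto intro!: has_vector_derivative_add d sc)
  note 3 = this
  show "Qform (add_to_third a A) i j t = Qform A i j t" if "j \<noteq> 3"
    using assms(3) that by (simp add: Qform_eqI[OF i[OF assms(3)] i[OF that]] Qform_eqI[OF d d] column_add_to_third)
  show "Qform (add_to_third a A) i 3 t = Qform A i 3 t + a 1 * Qform A i 1 t + a 2 * Qform A i 2 t
       + a 4 * Qform A i 4 t + a 5 * Qform A i 5 t"
    using assms(3)
    by (simp add: Qform_eqI[OF i[OF assms(3)] 3] Qform_eqI[OF d d] column_add_to_third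
        inner_add_left inner_add_right algebra_simps)
qed

text \<open>The new constants show how \<open>Q\<^sub>1\<^sub>3, Q\<^sub>2\<^sub>3, Q\<^sub>3\<^sub>4, Q\<^sub>3\<^sub>5\<close> can be controlled by the choice of \<open>a\<close>.\<close>

lemma time_conditions_add_to_third:
  assumes tc: "time_conditions I A c"
  obtains c' where "time_conditions I (add_to_third a A) c'" "c' 1 2 = c 1 2"
    "c' 1 3 = c 1 3 + a 2 * c 1 2"
    "c' 2 3 = c 2 3 - a 1 * c 1 2 + a 4 * c 2 4 + a 5 * c 2 5"
    "c' 3 4 = c 3 4 + a 2 * c 2 4 - a 5 * c 4 5"
    "c' 3 5 = c 3 5 + a 2 * c 2 5 + a 4 * c 4 5"
proof -
  note tcs = tc[unfolded time_conditions_iff]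
  have A: "smooth_on I A" using tcs by blast
  let ?B = "add_to_third a A"
  define c' where "c' = (\<lambda>(i::nat) (j::nat).
      if i = 1 \<and> j = 3 then c 1 3 + a 2 * c 1 2
      else if i = 2 \<and> j = 3 then c 2 3 - a 1 * c 1 2 + a 4 * c 2 4 + a 5 * c 2 5
      else if i = 3 \<and> j = 4 then c 3 4 + a 2 * c 2 4 - a 5 * c 4 5
      else if i = 3 \<and> j = 5 then c 3 5 + a 2 * c 2 5 + a 4 * c 4 5
      else c i j)"
  have smooth: "smooth_on I ?B"
  proof (rule smooth_on_columns)
    fix j
    have *: "smooth_on I (\<lambda>t. r *\<^sub>R column j (A t))" for r j
      by (rule smooth_on_linear[OF bounded_linear_scaleR_right smooth_on_column[OF A]])
    have "smooth_on I (\<lambda>t. column 3 (A t) + a 1 *\<^sub>R column 1 (A t) + a 2 *\<^sub>R column 2 (A t)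
       + a 4 *\<^sub>R column 4 (A t) + a 5 *\<^sub>R column 5 (A t))"
      by (rule smooth_on_add smooth_on_column[OF A] *)+
    then show "smooth_on I (\<lambda>t. column j (?B t))"
      unfolding column_add_to_third using smooth_on_column[OF A] by (cases "j = 3") simp_all
  qed
  have indep: "columns_independent_on I ?B"
    unfolding columns_independent_on_def
  proof (intro allI impI)
    fix x :: "5 \<Rightarrow> real" and j
    assume x: "\<forall>t\<in>I. (\<Sum>j\<in>UNIV. x j *\<^sub>R column j (?B t)) = 0"
    define y where "y j = (if j = 3 then x 3 else x j + x 3 * a j)" for j
    have "(\<Sum>j\<in>UNIV. y j *\<^sub>R column j (A t)) = (\<Sum>j\<in>UNIV. x j *\<^sub>R column j (?B t))" for t
      by (simp add: sum_5 y_def column_add_to_third algebra_simps)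
    then have y: "y j = 0" for j
      using x tcs unfolding columns_independent_on_def by simp
    then have "x 3 = 0" using y[of 3] by (simp add: y_def)
    then show "x j = 0" using y[of j] by (cases "j = 3") (simp_all add: y_def)
  qed
  have swap: "Qform M 3 j t = - Qform M j 3 t" for M j t by (rule Qform_swap)
  have old: "Qform A 2 1 t = - c 1 2" "Qform A 4 1 t = 0" "Qform A 4 2 t = - c 2 4"
      "Qform A 5 1 t = 0" "Qform A 5 2 t = - c 2 5" "Qform A 5 4 t = - c 4 5"
      "Qform A 4 3 t = - c 3 4" "Qform A 5 3 t = - c 3 5" if "t \<in> I" for t
    using tcs that Qform_swap[of A 2 1 t] Qform_swap[of A 4 1 t] Qform_swap[of A 4 2 t]
      Qform_swap[of A 5 1 t] Qform_swap[of A 5 2 t] Qform_swap[of A 5 4 t]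
      Qform_swap[of A 4 3 t] Qform_swap[of A 5 3 t] by simp_all
  have "time_conditions I ?B c'"
    unfolding time_conditions_iff
    using tcs smooth indep det_conditions_add_to_third
    by (simp add: Qform_add_to_third[OF A] swap[of ?B] old Qform_self c'_def)
  then show thesis by (rule that) (simp_all add: c'_def)
qed

section \<open>Moving orthonormal frames\<close>

lemma columns_Bmat:
  "column 1 (R ** Bmat b11 b12 b13 b22 b23 \<theta>) = b11 *\<^sub>R column 1 R"
  "column 2 (R ** Bmat b11 b12 b13 b22 b23 \<theta>) = b12 *\<^sub>R column 1 R + b22 *\<^sub>R column 2 R"
  "column 3 (R ** Bmat b11 b12 b13 b22 b23 \<theta>) =
     b13 *\<^sub>R column 1 R + b23 *\<^sub>R column 2 R + (1 / (b11 * b22)) *\<^sub>R column 3 R"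
  "rotated_pair (R ** Bmat b11 b12 b13 b22 b23 \<theta>) \<theta>"
  by (simp_all add: rotated_pair_def Bmat_def column_def matrix_matrix_mult_def vec_eq_iff sum_3 vector_5
      algebra_simps)

text \<open>The determinants and \<open>Q\<close> depend on the columns of \<open>A\<close>, so this is the form in which \<open>A = R B\<close> is both proved and
  used.\<close>

lemma eq_Bmat_iff:
  "M = R ** Bmat b 0 0 b 0 \<theta> \<longleftrightarrow> column 1 M = b *\<^sub>R column 1 R \<and> column 2 M = b *\<^sub>R column 2 R \<and>
     column 3 M = (1 / b\<^sup>2) *\<^sub>R column 3 R \<and> rotated_pair M \<theta>"
proof
  assume M: "M = R ** Bmat b 0 0 b 0 \<theta>"
  show "column 1 M = b *\<^sub>R column 1 R \<and> column 2 M = b *\<^sub>R column 2 R \<and>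
     column 3 M = (1 / b\<^sup>2) *\<^sub>R column 3 R \<and> rotated_pair M \<theta>"
    unfolding M using columns_Bmat(4)[of R b 0 0 b 0 \<theta>] by (simp add: columns_Bmat(1-3) power2_eq_square)
next
  assume M: "column 1 M = b *\<^sub>R column 1 R \<and> column 2 M = b *\<^sub>R column 2 R \<and>
     column 3 M = (1 / b\<^sup>2) *\<^sub>R column 3 R \<and> rotated_pair M \<theta>"
  then show "M = R ** Bmat b 0 0 b 0 \<theta>"
    using columns_Bmat(4)[of R b 0 0 b 0 \<theta>]
    by (simp add: matrix_eq_columns forall_5 rotated_pair_def columns_Bmat(1-3) power2_eq_square)
qed

lemma transpose_mult_nth: "(transpose M ** N) $ i $ j = column i M \<bullet> column j N"
  by (simp add: matrix_matrix_mult_def transpose_def column_def inner_vec_def)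

lemma orthogonal_matrix_iff_columns:
  fixes R :: "real^'n^'n"
  shows "orthogonal_matrix R \<longleftrightarrow> (\<forall>i j. column i R \<bullet> column j R = (if i = j then 1 else 0))"
  unfolding orthogonal_matrix vec_eq_iff transpose_mult_nth by (simp add: mat_def)

text \<open>The defining equation of \<open>w\<close>, tested on the standard basis. In this form it speaks of inner products between the
  columns of \<open>R\<close> and of \<open>R'\<close>, which are what \<open>Q\<close> sees.\<close>

lemma rotation_vector_on_iff:
  "rotation_vector_on I R w \<longleftrightarrow> (\<forall>t\<in>I. \<forall>k l. column l (R t) \<bullet> column k (vector_derivative R (at t))
     = (1/2) * (w t \<bullet> cross3 (axis k 1) (axis l 1)))"
proof -
  have "(\<forall>x. S *v x = (1/2) *\<^sub>R cross3 v x) \<longleftrightarrow> (\<forall>k l. S $ l $ k = (1/2) * (v \<bullet> cross3 (axis k 1) (axis l 1)))"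
    for S :: "real^3^3" and v
  proof
    assume S: "\<forall>x. S *v x = (1/2) *\<^sub>R cross3 v x"
    show "\<forall>k l. S $ l $ k = (1/2) * (v \<bullet> cross3 (axis k 1) (axis l 1))"
    proof (intro allI)
      fix k l
      have "S $ l $ k = (S *v axis k 1) $ l"
        by (simp add: matrix_vector_mult_basis column_def)
      also have "\<dots> = (1/2) * (cross3 v (axis k 1) \<bullet> axis l 1)"
        using S by (simp add: inner_axis)
      also have "cross3 v (axis k 1) \<bullet> axis l 1 = v \<bullet> cross3 (axis k 1) (axis l 1)"
        by (simp add: cross3_simps)
      finally show "S $ l $ k = (1/2) * (v \<bullet> cross3 (axis k 1) (axis l 1))" .
    qed
  next
    assume S: "\<forall>k l. S $ l $ k = (1/2) * (v \<bullet> cross3 (axis k 1) (axis l 1))"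
    show "\<forall>x. S *v x = (1/2) *\<^sub>R cross3 v x"
      by (simp add: S vec_eq_iff forall_3 matrix_vector_mult_def sum_3 cross3_def inner_vec_def axis_def algebra_simps)
  qed
  then show ?thesis
    unfolding rotation_vector_on_def transpose_mult_nth[symmetric] by simp
qed

text \<open>Differentiating the orthonormality of the columns shows that \<open>R\<^sup>T R'\<close> is skew-symmetric, and a skew-symmetric
  \<open>3 \<times> 3\<close> matrix is a cross product.\<close>

lemma rotation_vector_exists:
  assumes "open I" "smooth_on I R" "\<And>t. t \<in> I \<Longrightarrow> orthogonal_matrix (R t)"
  obtains w where "rotation_vector_on I R w"
proof
  let ?r = "\<lambda>t i. column i (R t)" and ?d = "\<lambda>t i. column i (vector_derivative R (at t))"
  \<comment> \<open>The entries below the diagonal of \<open>R\<^sup>T R'\<close>, up to sign, doubled because of the factor \<open>1/2\<close> in the definition.\<close>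
  define w :: "real \<Rightarrow> real^3" where
    "w t = 2 *\<^sub>R vector [?r t 3 \<bullet> ?d t 2, ?r t 1 \<bullet> ?d t 3, ?r t 2 \<bullet> ?d t 1]" for t
  have skew: "?r t i \<bullet> ?d t j = - (?r t j \<bullet> ?d t i)" if "t \<in> I" for t i j
  proof -
    note d = column_has_vector_derivative[OF assms(2) that]
    have "((\<lambda>s. ?r s i \<bullet> ?r s j) has_vector_derivative ?r t i \<bullet> ?d t j + ?d t i \<bullet> ?r t j) (at t)"
      by (rule bounded_bilinear.has_vector_derivative[OF bounded_bilinear_inner d d])
    moreover have "((\<lambda>s. ?r s i \<bullet> ?r s j) has_vector_derivative 0) (at t)"
      by (rule has_vector_derivative_transform_within_open[OF has_vector_derivative_const assms(1) that,
            of "if i = j then 1 else 0"])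
         (use assms(3) in \<open>simp add: orthogonal_matrix_iff_columns\<close>)
    ultimately show ?thesis
      using vector_derivative_unique_at by (fastforce simp: inner_commute)
  qed
  have diag: "?r t i \<bullet> ?d t i = 0" if "t \<in> I" for t i
    using skew[OF that, of i i] by simp
  show "rotation_vector_on I R w"
    unfolding rotation_vector_on_iff forall_3
    using diag skew[of _ 1 2] skew[of _ 2 3] skew[of _ 3 1]
    by (simp add: w_def inner_vec_def sum_3 cross3_def axis_def)
qed

text \<open>The derivatives of the scalar factors \<open>f, g\<close> drop out, because the two columns of \<open>R\<close> are orthogonal. The
  factor \<open>1/2\<close> in the definition of \<open>w\<close> is compensated by the two equal contributions of \<open>R'\<close>.\<close>

lemma Qform_moving_frame:
  assumes "open I" "smooth_on I R" "smooth_on I f" "smooth_on I g" "t \<in> I"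
    and "\<And>s. s \<in> I \<Longrightarrow> orthogonal_matrix (R s)" "rotation_vector_on I R w" "k \<noteq> l"
    and ci: "\<And>s. s \<in> I \<Longrightarrow> column i (A s) = f s *\<^sub>R column k (R s)"
    and cj: "\<And>s. s \<in> I \<Longrightarrow> column j (A s) = g s *\<^sub>R column l (R s)"
  shows "Qform A i j t = f t * g t * (w t \<bullet> cross3 (axis k 1) (axis l 1))"
proof -
  let ?r = "\<lambda>t i. column i (R t)" and ?d = "\<lambda>i. column i (vector_derivative R (at t))"
  have d: "((\<lambda>s. column i (A s)) has_vector_derivative f t *\<^sub>R ?d k + f' *\<^sub>R ?r t k) (at t)"
    if f': "(f has_vector_derivative f') (at t)"
      and ci: "\<And>s. s \<in> I \<Longrightarrow> column i (A s) = f s *\<^sub>R column k (R s)" for f f' i k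
  proof (rule has_vector_derivative_transform_within_open[OF _ assms(1,5)])
    show "((\<lambda>s. f s *\<^sub>R ?r s k) has_vector_derivative f t *\<^sub>R ?d k + f' *\<^sub>R ?r t k) (at t)"
      using f' column_has_vector_derivative[OF assms(2,5)]
      by (intro has_vector_derivative_scaleR) (simp_all add: has_real_derivative_iff_has_vector_derivative)
  qed (use ci in simp)
  note f' = smooth_on_has_vector_derivative[OF assms(3,5)] and g' = smooth_on_has_vector_derivative[OF assms(4,5)]
  have di: "((\<lambda>s. column i (A s)) has_vector_derivative
      f t *\<^sub>R ?d k + vector_derivative f (at t) *\<^sub>R ?r t k) (at t)"
    by (rule d[OF f' ci])
  have dj: "((\<lambda>s. column j (A s)) has_vector_derivative
      g t *\<^sub>R ?d l + vector_derivative g (at t) *\<^sub>R ?r t l) (at t)"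
    by (rule d[OF g' cj])
  have kl: "?r t k \<bullet> ?r t l = 0" "?r t l \<bullet> ?r t k = 0"
    using assms(6)[OF assms(5)] assms(8) by (auto simp: orthogonal_matrix_iff_columns)
  have Q: "Qform A i j t = f t * g t * (?d k \<bullet> ?r t l - ?d l \<bullet> ?r t k)"
    unfolding Qform_eqI[OF di dj] ci[OF assms(5)] cj[OF assms(5)]
    by (simp add: inner_add_left kl algebra_simps)
  have "?r t l \<bullet> ?d k = (1/2) * (w t \<bullet> cross3 (axis k 1) (axis l 1))" for k l
    using assms(7,5) unfolding rotation_vector_on_iff by blast
  then have "?d k \<bullet> ?r t l = (1/2) * (w t \<bullet> cross3 (axis k 1) (axis l 1))" for k l
    by (metis inner_commute)
  then have "?d k \<bullet> ?r t l - ?d l \<bullet> ?r t k = (1/2) * (w t \<bullet> cross3 (axis k 1) (axis l 1)) - (1/2) * (w t \<bullet> cross3 (axis l 1) (axis k 1))"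
    by metis
  also have "\<dots> = w t \<bullet> cross3 (axis k 1) (axis l 1)"
    unfolding cross_skew[of "axis l 1" "axis k 1"] by simp
  finally show ?thesis unfolding Q by simp
qed

lemma Qform_Bmat:
  assumes "open I" "smooth_on I R" "smooth_on I b" "\<And>s. s \<in> I \<Longrightarrow> b s \<noteq> 0" "t \<in> I"
    and "\<And>s. s \<in> I \<Longrightarrow> rotation_matrix (R s)" "rotation_vector_on I R w"
    and A: "\<And>s. s \<in> I \<Longrightarrow> A s = R s ** Bmat (b s) 0 0 (b s) 0 (\<theta> s)"
  shows "Qform A 1 2 t = (b t)\<^sup>2 * w t $ 3" "Qform A 1 3 t = - w t $ 2 / b t" "Qform A 2 3 t = w t $ 1 / b t"
proof -
  have orth: "orthogonal_matrix (R s)" if "s \<in> I" for s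
    using assms(6)[OF that] by (simp add: rotation_matrix_def)
  have cols: "column 1 (A s) = b s *\<^sub>R column 1 (R s)" "column 2 (A s) = b s *\<^sub>R column 2 (R s)"
     "column 3 (A s) = (1 / (b s)\<^sup>2) *\<^sub>R column 3 (R s)" if "s \<in> I" for s
    using A[OF that] unfolding eq_Bmat_iff by auto
  have b2: "smooth_on I (\<lambda>s. 1 / (b s)\<^sup>2)"
    unfolding power2_eq_square using assms(4)
    by (intro smooth_on_divide smooth_on_mult smooth_on_const assms(1,3)) simp
  have ax: "cross3 (axis 1 1) (axis 2 1) = axis 3 1" "cross3 (axis 1 1) (axis 3 1) = - axis 2 1"
      "cross3 (axis 2 1) (axis 3 1) = axis 1 1" by (simp_all add: cross_basis)
  note M = Qform_moving_frame[OF assms(1,2)]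
  show "Qform A 1 2 t = (b t)\<^sup>2 * w t $ 3"
    using M[of b b t w 1 2 1 A 2] assms(3,5,7) orth cols
    by (simp add: ax inner_axis power2_eq_square)
  show "Qform A 1 3 t = - w t $ 2 / b t"
    using M[of b "\<lambda>s. 1 / (b s)\<^sup>2" t w 1 3 1 A 3] assms(3,5,7) orth cols b2 assms(4)[OF assms(5)]
    by (simp add: ax inner_axis power2_eq_square)
  show "Qform A 2 3 t = w t $ 1 / b t"
    using M[of b "\<lambda>s. 1 / (b s)\<^sup>2" t w 2 3 2 A 3] assms(3,5,7) orth cols b2 assms(4)[OF assms(5)]
    by (simp add: ax inner_axis power2_eq_square)
qed

section \<open>The normal form\<close>

lemma det_eq_columns:
  fixes R :: "real^3^3"
  shows "det R = column 1 R \<bullet> cross3 (column 2 R) (column 3 R)"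
  by (simp add: column_def cross3_simps)

lemma inner_cross_cross:
  "cross3 x y \<bullet> cross3 x y = (x \<bullet> x) * (y \<bullet> y) - (x \<bullet> y)\<^sup>2"
  "x \<bullet> cross3 y (cross3 x y) = (x \<bullet> x) * (y \<bullet> y) - (x \<bullet> y)\<^sup>2"
  by (simp_all add: cross3_simps power2_eq_square)

text \<open>If \<open>Q\<^sub>i\<^sub>3 = 0\<close> for all \<open>i\<close>, then \<open>angular_speed_inner_products\<close> with \<open>i = 3\<close> makes \<open>A\<^sub>3\<close> perpendicular to \<open>A\<^sub>1\<close> and
  \<open>A\<^sub>2\<close>. The rotation \<open>R\<close> consists of the normalized \<open>A\<^sub>1, A\<^sub>2\<close> and their cross product, and \<open>p\<^sub>1\<^sub>2\<^sub>3 = 1\<close> fixes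
  the length of \<open>A\<^sub>3\<close>.\<close>

lemma normal_form_of_adapted:
  assumes I: "open I" "is_interval I" "I \<noteq> {}" and tc: "time_conditions I A c"
    and c0: "c 1 3 = 0" "c 2 3 = 0" "c 3 4 = 0" "c 3 5 = 0"
  obtains R b \<theta> w where "normal_form I A (c 1 2) R b (\<lambda>_. 0) (\<lambda>_. 0) b (\<lambda>_. 0) \<theta> w" "\<And>t. t \<in> I \<Longrightarrow> b t > 0"
proof -
  note tcs = tc[unfolded time_conditions_iff]
  have A: "smooth_on I A" using tcs by blast
  let ?a = "\<lambda>t i. column i (A t)"
  obtain \<theta> where \<theta>: "smooth_on I \<theta>" and rot: "\<And>t. t \<in> I \<Longrightarrow> rotated_pair (A t) (\<theta> t)"
    and c12: "c 1 2 \<noteq> 0"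
    and \<theta>': "\<And>t. t \<in> I \<Longrightarrow> (\<theta> has_real_derivative - c 1 2 / (?a t 1 \<bullet> ?a t 1)) (at t)"
    and a12: "\<And>t. t \<in> I \<Longrightarrow> ?a t 1 \<bullet> ?a t 2 = 0"
    and a22: "\<And>t. t \<in> I \<Longrightarrow> ?a t 2 \<bullet> ?a t 2 = ?a t 1 \<bullet> ?a t 1"
    using rotating_plane[OF I tc] by metis
  define b where "b = (\<lambda>t. sqrt (?a t 1 \<bullet> ?a t 1))"
  have p123: "?a t 1 \<bullet> cross3 (?a t 2) (?a t 3) = 1" if "t \<in> I" for t
    using tcs that by (simp add: det_conditions_def pdet_triple)
  have pos: "?a t 1 \<bullet> ?a t 1 > 0" if "t \<in> I" for t
    using p123[OF that] by (cases "?a t 1 = 0") simp_all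
  have b: "b t > 0" and b2: "?a t 1 \<bullet> ?a t 1 = b t * b t" if "t \<in> I" for t
    using pos[OF that] by (simp_all add: b_def)
  have b_smooth: "smooth_on I b"
    unfolding b_def by (intro smooth_on_sqrt smooth_on_inner I(1) smooth_on_column A pos)
  have Q3: "Qform A 3 1 t = 0" "Qform A 3 2 t = 0" "Qform A 3 4 t = 0" "Qform A 3 5 t = 0" if "t \<in> I" for t
    using tcs that c0 Qform_swap[of A 3 1 t] Qform_swap[of A 3 2 t] by simp_all
  have a13: "?a t 1 \<bullet> ?a t 3 = 0" "?a t 2 \<bullet> ?a t 3 = 0" if "t \<in> I" for t
    using angular_speed_inner_products[of I A \<theta> t _ 3] I(1) A rot that \<theta>'[OF that] Q3[OF that] c12 pos[OF that]
    by fastforce+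
  \<comment> \<open>\<open>vector\<close> lists rows, and the three vectors are to be columns; so the two indices are swapped.\<close>
  define R :: "real \<Rightarrow> real^3^3" where "R = (\<lambda>t. \<chi> i k.
    (vector [(1 / b t) *\<^sub>R ?a t 1, (1 / b t) *\<^sub>R ?a t 2, (1 / (b t * b t)) *\<^sub>R cross3 (?a t 1) (?a t 2)] :: real^3^3) $ k $ i)"
  have R: "column 1 (R t) = (1 / b t) *\<^sub>R ?a t 1" "column 2 (R t) = (1 / b t) *\<^sub>R ?a t 2"
    "column 3 (R t) = (1 / (b t * b t)) *\<^sub>R cross3 (?a t 1) (?a t 2)" for t
    by (simp_all add: R_def column_def vec_eq_iff)
  have R_smooth: "smooth_on I R"
  proof (rule smooth_on_columns)
    fix j :: 3
    have nz: "b t \<noteq> 0" "b t * b t \<noteq> 0" if "t \<in> I" for t using b[OF that] by auto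
    have ib: "smooth_on I (\<lambda>t. 1 / b t)" "smooth_on I (\<lambda>t. 1 / (b t * b t))"
      using nz by (intro smooth_on_divide smooth_on_mult smooth_on_const I(1) b_smooth; simp)+
    show "smooth_on I (\<lambda>t. column j (R t))"
      using exhaust_3[of j]
      by (elim disjE) (simp_all add: R smooth_on_scaleR[OF I(1)] ib smooth_on_column[OF A]
          smooth_on_cross[OF I(1)])
  qed
  have rotR: "rotation_matrix (R t)" if "t \<in> I" for t
  proof -
    note f = b[OF that] a12[OF that] a22[OF that] b2[OF that] inner_commute[of "?a t 2" "?a t 1"]
    show ?thesis
      unfolding rotation_matrix_def orthogonal_matrix_iff_columns forall_3 det_eq_columns
      using f by (simp add: R dot_cross_self inner_cross_cross cross_mult_left cross_mult_right)
  qed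
  obtain w where w: "rotation_vector_on I R w"
    using rotation_vector_exists[OF I(1) R_smooth] rotR unfolding rotation_matrix_def by blast
  have a3: "?a t 3 = (1 / (b t)\<^sup>2) *\<^sub>R column 3 (R t)" if "t \<in> I" for t
  proof -
    note f = b[OF that] a12[OF that] a22[OF that] b2[OF that] a13[OF that]
      inner_commute[of "?a t 2" "?a t 1"] inner_commute[of "?a t 3"]
    have "?a t 2 \<bullet> cross3 (?a t 3) (cross3 (?a t 1) (?a t 2)) = 0"
       and "?a t 1 \<bullet> cross3 (?a t 3) (cross3 (?a t 1) (?a t 2)) = 0"
       and "?a t 3 \<bullet> cross3 (?a t 2) (cross3 (?a t 1) (?a t 2)) = 0"
      using f by (simp_all add: Lagrange inner_diff_right)
    then have "(b t * b t * (b t * b t)) *\<^sub>R ?a t 3 = cross3 (?a t 1) (?a t 2)"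
      using cramer3[of "?a t 1" "?a t 2" "cross3 (?a t 1) (?a t 2)" "?a t 3"] p123[OF that] f
      by (simp add: inner_cross_cross)
    then have "cross3 (?a t 1) (?a t 2) = (b t * b t * (b t * b t)) *\<^sub>R ?a t 3" by simp
    then show ?thesis using b[OF that] by (simp add: R power2_eq_square)
  qed
  have AB: "A t = R t ** Bmat (b t) 0 0 (b t) 0 (\<theta> t)" if "t \<in> I" for t
    unfolding eq_Bmat_iff using b[OF that] rot[OF that] a3[OF that] by (simp add: R)
  have wt: "w t $ 1 = 0" "w t $ 2 = 0" "- c 1 2 / (b t)\<^sup>2 = - (w t $ 3)" if "t \<in> I" for t
  proof -
    have "b s \<noteq> 0" if "s \<in> I" for s using b[OF that] by simp
    note Q = Qform_Bmat[OF I(1) R_smooth b_smooth this that rotR w AB]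
    have "Qform A 1 2 t = c 1 2" "Qform A 1 3 t = 0" "Qform A 2 3 t = 0" using tcs that c0 by auto
    then show "w t $ 1 = 0" "w t $ 2 = 0" "- c 1 2 / (b t)\<^sup>2 = - (w t $ 3)"
      using Q b[OF that] by (auto simp: field_simps)
  qed
  show thesis
  proof (rule that)
    show "normal_form I A (c 1 2) R b (\<lambda>_. 0) (\<lambda>_. 0) b (\<lambda>_. 0) \<theta> w"
      unfolding normal_form_def
      using R_smooth b_smooth smooth_on_const \<theta> rotR w AB \<theta>' wt b2 by (simp add: power2_eq_square)
  qed (rule b)
qed

text \<open>\<open>Q\<^sub>1\<^sub>2, Q\<^sub>1\<^sub>3, Q\<^sub>2\<^sub>3\<close> come from the frame and determine all \<open>Q\<^sub>i\<^sub>4, Q\<^sub>i\<^sub>5\<close> by \<open>Qform_rotated_pair\<close>. A constant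
  relation between the columns is a relation between \<open>1, cos \<theta>, sin \<theta>\<close>, which are independent because
  \<open>\<theta>' = - k/b\<^sup>2\<close> does not vanish.\<close>

lemma normal_form_imp_time_conditions:
  assumes I: "open I" "I \<noteq> {}" and b: "\<And>t. t \<in> I \<Longrightarrow> b t \<noteq> 0" and k: "k \<noteq> 0"
    and nf: "normal_form I A k R b b12 b13 b22 b23 \<theta> w"
  shows "\<exists>c. time_conditions I A c \<and> c 1 2 = k"
proof -
  note nfs = nf[unfolded normal_form_def]
  have smooth: "smooth_on I R" "smooth_on I b" "smooth_on I \<theta>" and w: "rotation_vector_on I R w"
    and rotR: "\<And>t. t \<in> I \<Longrightarrow> rotation_matrix (R t)"
    and \<theta>': "\<And>t. t \<in> I \<Longrightarrow> (\<theta> has_real_derivative - k / (b t)\<^sup>2) (at t)"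
    and wt: "\<And>t. t \<in> I \<Longrightarrow> w t $ 1 = 0 \<and> w t $ 2 = 0 \<and> w t $ 3 = k / (b t)\<^sup>2"
    and AB: "\<And>t. t \<in> I \<Longrightarrow> A t = R t ** Bmat (b t) 0 0 (b t) 0 (\<theta> t)"
    using nfs by auto
  let ?a = "\<lambda>t i. column i (A t)" and ?r = "\<lambda>t i. column i (R t)"
  have a: "?a t 1 = b t *\<^sub>R ?r t 1" "?a t 2 = b t *\<^sub>R ?r t 2" "?a t 3 = (1 / (b t)\<^sup>2) *\<^sub>R ?r t 3"
    and rot: "rotated_pair (A t) (\<theta> t)" if "t \<in> I" for t
    using AB[OF that] unfolding eq_Bmat_iff by auto
  have r: "?r t i \<bullet> ?r t j = (if i = j then 1 else 0)" if "t \<in> I" for t i j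
    using rotR[OF that] by (simp add: rotation_matrix_def orthogonal_matrix_iff_columns)
  have ib: "smooth_on I (\<lambda>t. 1 / (b t)\<^sup>2)"
    unfolding power2_eq_square using b by (intro smooth_on_divide smooth_on_mult smooth_on_const I(1) smooth(2)) simp
  have a_smooth: "smooth_on I (\<lambda>t. ?a t 1)" "smooth_on I (\<lambda>t. ?a t 2)" "smooth_on I (\<lambda>t. ?a t 3)"
  proof -
    show "smooth_on I (\<lambda>t. ?a t 1)"
      by (rule smooth_on_cong[OF I(1) _ smooth_on_scaleR[OF I(1) smooth(2) smooth_on_column[OF smooth(1), of 1]]])
         (use a in simp)
    show "smooth_on I (\<lambda>t. ?a t 2)"
      by (rule smooth_on_cong[OF I(1) _ smooth_on_scaleR[OF I(1) smooth(2) smooth_on_column[OF smooth(1), of 2]]])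
         (use a in simp)
    show "smooth_on I (\<lambda>t. ?a t 3)"
      by (rule smooth_on_cong[OF I(1) _ smooth_on_scaleR[OF I(1) ib smooth_on_column[OF smooth(1), of 3]]])
         (use a in simp)
  qed
  have comb: "smooth_on I (\<lambda>t. f t *\<^sub>R ?a t 1 + g t *\<^sub>R ?a t 2)" if "smooth_on I f" "smooth_on I g" for f g
    by (intro smooth_on_add smooth_on_scaleR I(1) that a_smooth)
  note cs = smooth_on_cos_sin[OF I(1) smooth(3)]
  have a_smooth': "smooth_on I (\<lambda>t. ?a t 4)" "smooth_on I (\<lambda>t. ?a t 5)"
  proof -
    show "smooth_on I (\<lambda>t. ?a t 4)"
      by (rule smooth_on_cong[OF I(1) _ comb[OF cs]]) (use rot in \<open>simp add: rotated_pair_def\<close>)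
    show "smooth_on I (\<lambda>t. ?a t 5)"
      by (rule smooth_on_cong[OF I(1) _ comb[OF smooth_on_minus[OF cs(2)] cs(1)]])
         (use rot in \<open>simp add: rotated_pair_def\<close>)
  qed
  have A: "smooth_on I A"
  proof (rule smooth_on_columns)
    fix j :: 5
    show "smooth_on I (\<lambda>t. column j (A t))"
      using exhaust_5[of j] a_smooth a_smooth' by (elim disjE) simp_all
  qed
  have det: "det_conditions (A t)" if "t \<in> I" for t
  proof (rule rotated_pair_imp_det_conditions[OF rot[OF that]])
    have "?r t 1 \<bullet> cross3 (?r t 2) (?r t 3) = 1"
      using rotR[OF that] unfolding rotation_matrix_def det_eq_columns by blast
    then show "pdet (A t) 1 2 3 = 1"
      using b[OF that] by (simp add: pdet_triple a[OF that] cross_mult_left cross_mult_right power2_eq_square)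
  qed
  have indep: "columns_independent_on I A"
    unfolding columns_independent_on_def
  proof (intro allI impI)
    fix x :: "5 \<Rightarrow> real" and j
    assume x: "\<forall>t\<in>I. (\<Sum>j\<in>UNIV. x j *\<^sub>R column j (A t)) = 0"
    have sum: "(x 1 + x 4 * cos (\<theta> t) - x 5 * sin (\<theta> t)) *\<^sub>R ?a t 1 +
        (x 2 + x 4 * sin (\<theta> t) + x 5 * cos (\<theta> t)) *\<^sub>R ?a t 2 + x 3 *\<^sub>R ?a t 3 = 0" if "t \<in> I" for t
    proof -
      note e = rot[OF that, unfolded rotated_pair_def]
      have "(\<Sum>j\<in>UNIV. x j *\<^sub>R ?a t j) = 0" using x that by blast
      then show ?thesis
        unfolding sum_5 conjunct1[OF e] conjunct2[OF e] by (simp add: algebra_simps)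
    qed
    have coeffs: "x 1 + x 4 * cos (\<theta> t) - x 5 * sin (\<theta> t) = 0"
        "x 2 + x 4 * sin (\<theta> t) + x 5 * cos (\<theta> t) = 0" "x 3 = 0" if "t \<in> I" for t
      using arg_cong[OF sum[OF that], of "\<lambda>v. v \<bullet> ?r t 1"] arg_cong[OF sum[OF that], of "\<lambda>v. v \<bullet> ?r t 2"]
        arg_cong[OF sum[OF that], of "\<lambda>v. v \<bullet> ?r t 3"] b[OF that]
      by (simp_all add: inner_add_left a[OF that] r[OF that])
    obtain t0 where t0: "t0 \<in> I" using I(2) by blast
    have nz: "- k / (b t)\<^sup>2 \<noteq> 0" if "t \<in> I" for t using k b[OF that] by simp
    have trig: "x 4 * cos (\<theta> t) + (- x 5) * sin (\<theta> t) + x 1 = 0" if "t \<in> I" for t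
      using coeffs(1)[OF that] by simp
    have "x 4 = 0 \<and> - x 5 = 0 \<and> x 1 = 0"
      by (rule cos_sin_const_independent[OF I(1) t0 \<theta>' nz trig])
    then show "x j = 0" using coeffs(2,3)[OF t0] exhaust_5[of j] by (elim disjE) simp_all
  qed
  have ip: "?a t 1 \<bullet> ?a t 1 = (b t)\<^sup>2" "?a t 2 \<bullet> ?a t 2 = (b t)\<^sup>2" "?a t 1 \<bullet> ?a t 2 = 0" "?a t 2 \<bullet> ?a t 1 = 0"
     "?a t 1 \<bullet> ?a t 3 = 0" "?a t 2 \<bullet> ?a t 3 = 0" if "t \<in> I" for t
    by (simp_all add: a[OF that] r[OF that] power2_eq_square)
  have Q: "Qform A 1 2 t = k" "Qform A 1 3 t = 0" "Qform A 2 3 t = 0" if "t \<in> I" for t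
    using Qform_Bmat[OF I(1) smooth(1,2) b that rotR w AB] wt[OF that] b[OF that] by simp_all
  have Q': "Qform A i 4 t = cos (\<theta> t) * Qform A i 1 t + sin (\<theta> t) * Qform A i 2 t
            - (- k / (b t)\<^sup>2) * (?a t 5 \<bullet> ?a t i)"
    "Qform A i 5 t = - sin (\<theta> t) * Qform A i 1 t + cos (\<theta> t) * Qform A i 2 t
            + (- k / (b t)\<^sup>2) * (?a t 4 \<bullet> ?a t i)" if "t \<in> I" for t i
    using Qform_rotated_pair[of I A \<theta> t "- k / (b t)\<^sup>2" i] I(1) A rot \<theta>'[OF that] that by simp_all
  have Qr: "Qform A 2 1 t = - k" "Qform A 3 1 t = 0" "Qform A 3 2 t = 0" if "t \<in> I" for t
    using Q[OF that] Qform_swap[of A 2 1 t] Qform_swap[of A 3 1 t] Qform_swap[of A 3 2 t] by simp_all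
  have Q4: "Qform A 1 4 t = 0" "Qform A 1 5 t = 0" "Qform A 2 4 t = 0" "Qform A 2 5 t = 0"
      "Qform A 3 4 t = 0" "Qform A 3 5 t = 0" if "t \<in> I" for t
    using b[OF that] by (simp_all add: Q'[OF that] inner_rotated_pair[OF rot[OF that]] ip[OF that] Q[OF that] Qr[OF that] Qform_self)
  have "?a t 4 \<bullet> ?a t 4 = (b t)\<^sup>2" if "t \<in> I" for t
    using rotated_pair_length[OF rot[OF that]] ip[OF that] by simp
  then have Q5: "Qform A 4 5 t = - k" if "t \<in> I" for t
    using Q'(2)[OF that, of 4] Qform_swap[of A 4 1 t] Qform_swap[of A 4 2 t] Q4[OF that] b[OF that] that by simp
  define c where "c = (\<lambda>(i::nat) (j::nat). if i = 1 \<and> j = 2 then k else if i = 4 \<and> j = 5 then - k else 0)"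
  have "time_conditions I A c"
    unfolding time_conditions_iff using A indep det Q Q4 Q5 by (simp add: c_def)
  then show ?thesis by (intro exI[of _ c]) (simp add: c_def)
qed

text \<open>A rotation about the third axis by an angle \<open>\<psi>\<close> has \<open>w = (0, 0, 2 \<psi>')\<close>, so that \<open>w\<^sub>3 = - \<theta>'\<close> forces
  \<open>\<psi> = - \<theta>/2\<close> up to a constant.\<close>

lemma normal_form_exists:
  assumes I: "open I" "is_interval I" and b: "smooth_on I b" "\<And>t. t \<in> I \<Longrightarrow> b t \<noteq> 0"
  shows "\<exists>A R b12 b13 b22 b23 \<theta> w. normal_form I A k R b b12 b13 b22 b23 \<theta> w"
proof -
  have "smooth_on I (\<lambda>t. - k / (b t)\<^sup>2)"
    unfolding power2_eq_square using b(2) by (intro smooth_on_divide smooth_on_mult smooth_on_const I(1) b(1)) simp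
  then obtain \<theta> where \<theta>: "smooth_on I \<theta>" "\<And>t. t \<in> I \<Longrightarrow> (\<theta> has_real_derivative - k / (b t)\<^sup>2) (at t)"
    using smooth_on_imp_antiderivative[OF I] by blast
  \<comment> \<open>A combination of constant matrices can be differentiated without going to entries.\<close>
  define P J E :: "real^3^3" where
    "P = vector [vector [1, 0, 0], vector [0, 1, 0], vector [0, 0, 0]]"
    "J = vector [vector [0, -1, 0], vector [1, 0, 0], vector [0, 0, 0]]"
    "E = vector [vector [0, 0, 0], vector [0, 0, 0], vector [0, 0, 1]]"
  define \<psi> where "\<psi> = (\<lambda>t. (-1/2) * \<theta> t)"
  define R where "R = (\<lambda>t. cos (\<psi> t) *\<^sub>R P + sin (\<psi> t) *\<^sub>R J + E)"
  define w :: "real \<Rightarrow> real^3" where "w = (\<lambda>t. vector [0, 0, k / (b t)\<^sup>2])"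
  have \<psi>: "smooth_on I \<psi>" unfolding \<psi>_def by (intro smooth_on_mult I(1) smooth_on_const \<theta>(1))
  have R_smooth: "smooth_on I R"
    unfolding R_def by (intro smooth_on_add smooth_on_scaleR I(1) smooth_on_cos_sin[OF I(1) \<psi>] smooth_on_const)
  have rotR: "rotation_matrix (R t)" for t
    unfolding rotation_matrix_def orthogonal_matrix_iff_columns det_3
    by (simp add: forall_3 R_def P_J_E_def column_def inner_vec_def sum_3 flip: power2_eq_square)
  have w: "rotation_vector_on I R w"
    unfolding rotation_vector_on_iff
  proof (intro ballI)
    fix t assume t: "t \<in> I"
    let ?R' = "(- sin (\<psi> t) * (k / (2 * (b t)\<^sup>2))) *\<^sub>R P + (cos (\<psi> t) * (k / (2 * (b t)\<^sup>2))) *\<^sub>R J"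
    have \<psi>': "(\<psi> has_real_derivative k / (2 * (b t)\<^sup>2)) (at t)"
      unfolding \<psi>_def using \<theta>(2)[OF t] by (auto intro!: derivative_eq_intros)
    have "((\<lambda>t. cos (\<psi> t)) has_real_derivative - sin (\<psi> t) * (k / (2 * (b t)\<^sup>2))) (at t)"
      "((\<lambda>t. sin (\<psi> t)) has_real_derivative cos (\<psi> t) * (k / (2 * (b t)\<^sup>2))) (at t)"
      using \<psi>' by (auto intro!: derivative_eq_intros)
    note d = has_vector_derivative_scaleR[OF this(1) has_vector_derivative_const[of P]]
      has_vector_derivative_scaleR[OF this(2) has_vector_derivative_const[of J]]
    have "(R has_vector_derivative ?R') (at t)"
      unfolding R_def
      using has_vector_derivative_add[OF has_vector_derivative_add[OF d] has_vector_derivative_const[of E]] by simp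
    then have R': "vector_derivative R (at t) = ?R'" by (rule vector_derivative_at)
    have cs: "cos (\<psi> t) * (cos (\<psi> t) * x) + sin (\<psi> t) * (sin (\<psi> t) * x) = x" for x
    proof -
      have "cos (\<psi> t) * (cos (\<psi> t) * x) + sin (\<psi> t) * (sin (\<psi> t) * x) = ((cos (\<psi> t))\<^sup>2 + (sin (\<psi> t))\<^sup>2) * x"
        by algebra
      then show ?thesis by simp
    qed
    show "\<forall>k l. column l (R t) \<bullet> column k (vector_derivative R (at t)) = (1/2) * (w t \<bullet> cross3 (axis k 1) (axis l 1))"
      unfolding R' forall_3
      using cs[of "k / (2 * (b t)\<^sup>2)"] cs[of "k / (b t)\<^sup>2"]
      by (simp add: R_def P_J_E_def w_def column_def inner_vec_def sum_3 cross3_def axis_def algebra_simps)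
  qed
  have "normal_form I (\<lambda>t. R t ** Bmat (b t) 0 0 (b t) 0 (\<theta> t)) k R b (\<lambda>_. 0) (\<lambda>_. 0) b (\<lambda>_. 0) \<theta> w"
    unfolding normal_form_def using R_smooth b(1) smooth_on_const \<theta> rotR w by (simp add: w_def)
  then show ?thesis by blast
qed

theorem theorem5p2:
  fixes I :: "real set"
  assumes "open I" and "is_interval I" and "I \<noteq> {}"
  shows
    "(\<forall>A c. time_conditions I A c \<longrightarrow>
        c 1 2 \<noteq> 0 \<and>
        (\<forall>a. \<exists>c'. time_conditions I (add_to_third a A) c') \<and>
        (\<exists>a R b11 b12 b13 b22 b23 \<theta> w.
           normal_form I (add_to_third a A) (c 1 2) R b11 b12 b13 b22 b23 \<theta> w \<and>
           (\<forall>t\<in>I. b11 t > 0 \<and> b22 t > 0)))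
     \<and>
     (\<forall>b11 c12. smooth_on I b11 \<and> (\<forall>t\<in>I. b11 t \<noteq> 0) \<and> c12 \<noteq> 0 \<longrightarrow>
        (\<exists>A R b12 b13 b22 b23 \<theta> w. normal_form I A c12 R b11 b12 b13 b22 b23 \<theta> w) \<and>
        (\<forall>A R b12 b13 b22 b23 \<theta> w. normal_form I A c12 R b11 b12 b13 b22 b23 \<theta> w \<longrightarrow>
           (\<exists>c. time_conditions I A c \<and> c 1 2 = c12)))"
proof (rule conjI; intro allI impI)
  fix A c assume tc: "time_conditions I A c"
  obtain c12: "c 1 2 \<noteq> 0" and c0: "c 2 4 = 0" "c 2 5 = 0" "c 4 5 = - c 1 2"
    using rotating_plane[OF assms tc] by metis
  \<comment> \<open>The solution of the four equations that make the new \<open>Q\<^sub>1\<^sub>3, Q\<^sub>2\<^sub>3, Q\<^sub>3\<^sub>4, Q\<^sub>3\<^sub>5\<close> vanish.\<close>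
  define a :: "5 \<Rightarrow> real" where "a j =
    (if j = 1 then c 2 3 / c 1 2 else if j = 2 then - c 1 3 / c 1 2
     else if j = 4 then c 3 5 / c 1 2 else - c 3 4 / c 1 2)" for j
  obtain c' where tc': "time_conditions I (add_to_third a A) c'" "c' 1 2 = c 1 2"
    and c': "c' 1 3 = 0" "c' 2 3 = 0" "c' 3 4 = 0" "c' 3 5 = 0"
    by (rule time_conditions_add_to_third[OF tc, of a]) (use c12 c0 in \<open>simp add: a_def\<close>)
  obtain R b \<theta> w where
    "normal_form I (add_to_third a A) (c 1 2) R b (\<lambda>_. 0) (\<lambda>_. 0) b (\<lambda>_. 0) \<theta> w"
    "\<And>t. t \<in> I \<Longrightarrow> b t > 0"
    using normal_form_of_adapted[OF assms tc'(1) c'] unfolding tc'(2) by metis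
  moreover have "\<exists>c'. time_conditions I (add_to_third a A) c'" for a
    by (rule time_conditions_add_to_third[OF tc, of a]) blast
  ultimately show "c 1 2 \<noteq> 0 \<and>
        (\<forall>a. \<exists>c'. time_conditions I (add_to_third a A) c') \<and>
        (\<exists>a R b11 b12 b13 b22 b23 \<theta> w.
           normal_form I (add_to_third a A) (c 1 2) R b11 b12 b13 b22 b23 \<theta> w \<and>
           (\<forall>t\<in>I. b11 t > 0 \<and> b22 t > 0))"
    using c12 by blast
next
  fix b11 :: "real \<Rightarrow> real" and c12 :: real
  assume b: "smooth_on I b11 \<and> (\<forall>t\<in>I. b11 t \<noteq> 0) \<and> c12 \<noteq> 0"
  show "(\<exists>A R b12 b13 b22 b23 \<theta> w. normal_form I A c12 R b11 b12 b13 b22 b23 \<theta> w) \<and>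
        (\<forall>A R b12 b13 b22 b23 \<theta> w. normal_form I A c12 R b11 b12 b13 b22 b23 \<theta> w \<longrightarrow>
           (\<exists>c. time_conditions I A c \<and> c 1 2 = c12))"
  proof (intro conjI allI impI)
    show "\<exists>A R b12 b13 b22 b23 \<theta> w. normal_form I A c12 R b11 b12 b13 b22 b23 \<theta> w"
      using b by (intro normal_form_exists assms(1,2)) auto
  next
    fix A R b12 b13 b22 b23 \<theta> w
    assume "normal_form I A c12 R b11 b12 b13 b22 b23 \<theta> w"
    then show "\<exists>c. time_conditions I A c \<and> c 1 2 = c12"
      using normal_form_imp_time_conditions[OF assms(1,3)] b by blast
  qed
qed

end
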